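(* Let $\mathcal{L}$ be any fixed linear equation. Then $\mathcal{L}$-\textsc{Free Subset}, parameterised by $|A|-k$, belongs to $\mathsf{FPT}$.
   Context: A linear equation $c_1x_1+\dots+c_\ell x_\ell=d$ has fixed integer coefficients. A solution is trivial if there is a partition $P_1,\dots,P_r$ of $\{1,\dots,\ell\}$ such that $x_i=x_j$ for $i,j$ in the same class and $\sum_{i\in P_s}c_i=0$ for each class. A set is $\mathcal{L}$-free if it contains no non-trivial solution. $\mathcal{L}$-\textsc{Free Subset}: given a finite $A\subseteq\mathbb{Z}$ and $k\in\mathbb{N}$, decide whether $A$ has an $\mathcal{L}$-free subset of size exactly $k$. $\mathsf{FPT}$ with parameter $p$ means solvable in time $f(p)\cdot n^{\mathcal{O}(1)}$ for a computable $f$, $n$ the input size in bits. *)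

theory Defs
  imports Main "HOL-Library.Disjoint_Sets"
begin

section \<open>Solution-free sets\<close>

text \<open>The equation \<open>c\<^sub>1 x\<^sub>1 + \<dots> + c\<^sub>\<ell> x\<^sub>\<ell> = d\<close> is given by its coefficient list \<open>c\<close>, with
  \<open>\<ell> = length c\<close>, and the constant \<open>d\<close>. Positions are counted from 0.\<close>

definition is_solution :: "int list \<Rightarrow> int \<Rightarrow> int list \<Rightarrow> bool" where
  "is_solution c d x \<longleftrightarrow> length x = length c \<and> (\<Sum>i<length c. c ! i * x ! i) = d"

definition trivial_solution :: "int list \<Rightarrow> int list \<Rightarrow> bool" where
  "trivial_solution c x \<longleftrightarrow>
     (\<exists>\<P>. partition_on {..<length c} \<P> \<and>
          (\<forall>P\<in>\<P>. (\<forall>i\<in>P. \<forall>j\<in>P. x ! i = x ! j) \<and> (\<Sum>i\<in>P. c ! i) = 0))"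

definition L_free :: "int list \<Rightarrow> int \<Rightarrow> int set \<Rightarrow> bool" where
  "L_free c d S \<longleftrightarrow>
     \<not> (\<exists>x. set x \<subseteq> S \<and> is_solution c d x \<and> \<not> trivial_solution c x)"


section \<open>Random access machines\<close>

text \<open>Programs for a random access machine whose registers hold integers and are indexed by
  integers. Each elementary instruction and each test has unit cost. Since addition and
  subtraction are the only arithmetic operations, every step increases the maximal bit length
  of the register contents by at most a constant, so this cost measure agrees with Turing
  machine time up to a polynomial.\<close>

datatype com =
    Skip
  | Const int int           \<comment> \<open>\<open>R[a] := v\<close>\<close>
  | Add int int int         \<comment> \<open>\<open>R[a] := R[b] + R[c]\<close>\<close>
  | Sub int int int         \<comment> \<open>\<open>R[a] := R[b] - R[c]\<close>\<close>
  | Load int int            \<comment> \<open>\<open>R[a] := R[R[b]]\<close>\<close>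
  | Store int int           \<comment> \<open>\<open>R[R[a]] := R[b]\<close>\<close>
  | Seq com com
  | IfPos int com com       \<comment> \<open>branch on \<open>R[a] > 0\<close>\<close>
  | WhilePos int com        \<comment> \<open>loop while \<open>R[a] > 0\<close>\<close>

type_synonym memory = "int \<Rightarrow> int"

text \<open>\<open>exec p R t R'\<close>: started in \<open>R\<close>, the program \<open>p\<close> halts after exactly \<open>t\<close> steps in \<open>R'\<close>.\<close>

inductive exec :: "com \<Rightarrow> memory \<Rightarrow> nat \<Rightarrow> memory \<Rightarrow> bool" where
  Skip: "exec Skip R 1 R"
| Const: "exec (Const a v) R 1 (R(a := v))"
| Add: "exec (Add a b c) R 1 (R(a := R b + R c))"
| Sub: "exec (Sub a b c) R 1 (R(a := R b - R c))"
| Load: "exec (Load a b) R 1 (R(a := R (R b)))"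
| Store: "exec (Store a b) R 1 (R(R a := R b))"
| Seq: "exec p R t R' \<Longrightarrow> exec q R' u R'' \<Longrightarrow> exec (Seq p q) R (t + u) R''"
| IfTrue: "R a > 0 \<Longrightarrow> exec p R t R' \<Longrightarrow> exec (IfPos a p q) R (1 + t) R'"
| IfFalse: "\<not> R a > 0 \<Longrightarrow> exec q R t R' \<Longrightarrow> exec (IfPos a p q) R (1 + t) R'"
| WhileFalse: "\<not> R a > 0 \<Longrightarrow> exec (WhilePos a p) R 1 R"
| WhileTrue: "R a > 0 \<Longrightarrow> exec p R t R' \<Longrightarrow> exec (WhilePos a p) R' u R'' \<Longrightarrow>
    exec (WhilePos a p) R (1 + t + u) R''"

inductive_cases exec_elims:
  "exec Skip R t R'" "exec (Const a v) R t R'" "exec (Add a b c) R t R'"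
  "exec (Sub a b c) R t R'" "exec (Load a b) R t R'" "exec (Store a b) R t R'"
  "exec (Seq p q) R t R'" "exec (IfPos a p q) R t R'"

inductive_cases exec_WhileE: "exec (WhilePos a p) R t R'"

lemma exec_deterministic:
  "exec p R t R' \<Longrightarrow> exec p R u S \<Longrightarrow> u = t \<and> S = R'"
proof (induction arbitrary: u S rule: exec.induct)
  case (Seq p R t R' q v R'')
  from Seq.prems obtain t1 t2 R1 where 1: "exec p R t1 R1" "exec q R1 t2 S" "u = t1 + t2"
    by (rule exec_elims)
  from Seq.IH(1)[OF 1(1)] Seq.IH(2) 1 show ?case by simp
next
  case (IfTrue R a p t R' q)
  from IfTrue.prems IfTrue.hyps obtain t1 where 1: "exec p R t1 S" "u = 1 + t1"
    by (auto elim: exec_elims)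
  from IfTrue.IH[OF 1(1)] 1(2) show ?case by simp
next
  case (IfFalse R a q t R' p)
  from IfFalse.prems IfFalse.hyps obtain t1 where 1: "exec q R t1 S" "u = 1 + t1"
    by (auto elim: exec_elims)
  from IfFalse.IH[OF 1(1)] 1(2) show ?case by simp
next
  case (WhileFalse R a p)
  from WhileFalse.prems WhileFalse.hyps show ?case by (auto elim: exec_WhileE)
next
  case (WhileTrue R a p t R' v R'')
  from WhileTrue.prems WhileTrue.hyps(1) obtain t1 t2 R1
    where 1: "exec p R t1 R1" "exec (WhilePos a p) R1 t2 S" "u = 1 + t1 + t2"
    by (auto elim: exec_WhileE)
  from WhileTrue.IH(1)[OF 1(1)] WhileTrue.IH(2) 1 show ?case by simp
qed (erule exec_elims, simp)+

text \<open>A bit string of length \<open>n\<close> is presented with its length in register 0 and its bits in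
  registers \<open>1, \<dots>, n\<close>; all other registers are 0. The answer is read from register 0.\<close>

definition input_memory :: "bool list \<Rightarrow> memory" where
  "input_memory w = (\<lambda>a.
     if a = 0 then int (length w)
     else if 1 \<le> a \<and> a \<le> int (length w) then of_bool (w ! nat (a - 1))
     else 0)"

definition decides_within :: "com \<Rightarrow> bool list \<Rightarrow> bool \<Rightarrow> nat \<Rightarrow> bool" where
  "decides_within p w answer T \<longleftrightarrow>
     (\<exists>t R. exec p (input_memory w) t R \<and> t \<le> T \<and> R 0 = of_bool answer)"

definition computable :: "(nat \<Rightarrow> nat) \<Rightarrow> bool" where
  "computable f \<longleftrightarrow>
     (\<exists>p. \<forall>m. \<exists>t R. exec p ((\<lambda>_. 0)(0 := int m)) t R \<and> R 0 = int (f m))"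


section \<open>Fixed-parameter tractability\<close>

text \<open>A parameterised problem consists of a set of instances, an encoding of the instances as
  bit strings, the property to be decided, and the parameter \<open>\<kappa>\<close>. The encoding
  is expected to produce nonempty strings, so that \<open>n ^ e\<close> does not vanish.\<close>

definition FPT :: "'i set \<Rightarrow> ('i \<Rightarrow> bool list) \<Rightarrow> ('i \<Rightarrow> bool) \<Rightarrow> ('i \<Rightarrow> nat) \<Rightarrow> bool" where
  "FPT Inst enc yes \<kappa> \<longleftrightarrow>
     (\<exists>p f e. computable f \<and>
        (\<forall>x\<in>Inst. decides_within p (enc x) (yes x) (f (\<kappa> x) * length (enc x) ^ e)))"


section \<open>The problem L-Free Subset\<close>

definition instances :: "(int set \<times> nat) set" where
  "instances = {(A, k). finite A}"

definition L_free_subset :: "int list \<Rightarrow> int \<Rightarrow> int set \<times> nat \<Rightarrow> bool" where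
  "L_free_subset c d = (\<lambda>(A, k). \<exists>S\<subseteq>A. card S = k \<and> L_free c d S)"

text \<open>Natural subtraction truncates: instances with \<open>k > |A|\<close>, which are trivially negative,
  have parameter 0.\<close>

definition deletion_parameter :: "int set \<times> nat \<Rightarrow> nat" where
  "deletion_parameter = (\<lambda>(A, k). card A - k)"

text \<open>Binary digits, least significant first.\<close>

fun bits :: "nat \<Rightarrow> bool list" where
  "bits n = (if n = 0 then [] else odd n # bits (n div 2))"

declare bits.simps [simp del]

text \<open>To make the code self-delimiting, each digit is preceded by \<open>True\<close> and the number is
  terminated by \<open>False\<close>. Integers carry a leading sign bit.\<close>

definition encode_nat :: "nat \<Rightarrow> bool list" where
  "encode_nat n = concat (map (\<lambda>b. [True, b]) (bits n)) @ [False]"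

definition encode_int :: "int \<Rightarrow> bool list" where
  "encode_int z = (z < 0) # encode_nat (nat \<bar>z\<bar>)"

definition encode_instance :: "int set \<times> nat \<Rightarrow> bool list" where
  "encode_instance = (\<lambda>(A, k).
     encode_nat k @ concat (map encode_int (sorted_list_of_set A)))"

end

theory Submission imports Defs begin

text \<open>A set \<open>S\<close> with \<open>|S| > k\<close> either is free itself or contains a nontrivial solution \<open>y\<close>, and every free
  subset misses one of the at most \<open>\<ell>\<close> values of \<open>y\<close>. In the second case \<open>S\<close> is replaced by
  the sets \<open>S - {y\<^sub>j}\<close>; this search tree has depth \<open>|A| - k\<close> and branching degree \<open>\<ell>\<close>, and a node is
  processed by trying all \<open>|S|\<^sup>\<ell>\<close> tuples. The pending nodes are kept in a queue, and the number of
  iterations is bounded by letting a pending set \<open>S\<close> weigh \<open>(\<ell> + 1)\<close> to the power \<open>|S| - k\<close>: this exceeds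
  the total weight of the \<open>\<ell>\<close> children. A solution is trivial iff the coefficients sum to 0 on each
  of its level sets, which is what the machine tests.\<close>

section \<open>Total correctness with running time\<close>

text \<open>A derivation of \<open>exec\<close> exists only for a halting run, so the existential
  makes this total correctness. The step count is handed to the postcondition, which lets time
  bounds and results be proved together.\<close>

definition wp :: "com \<Rightarrow> (nat \<Rightarrow> memory \<Rightarrow> bool) \<Rightarrow> memory \<Rightarrow> bool" where
  "wp p Q R \<longleftrightarrow> (\<exists>t R'. exec p R t R' \<and> Q t R')"

lemma wp_conseq: "wp p Q R \<Longrightarrow> (\<And>t R'. Q t R' \<Longrightarrow> Q' t R') \<Longrightarrow> wp p Q' R"
  unfolding wp_def by blast

lemma wp_simps [simp]:
  "wp Skip Q R \<longleftrightarrow> Q 1 R"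
  "wp (Const a v) Q R \<longleftrightarrow> Q 1 (R(a := v))"
  "wp (Add a b c) Q R \<longleftrightarrow> Q 1 (R(a := R b + R c))"
  "wp (Sub a b c) Q R \<longleftrightarrow> Q 1 (R(a := R b - R c))"
  "wp (Load a b) Q R \<longleftrightarrow> Q 1 (R(a := R (R b)))"
  "wp (Store a b) Q R \<longleftrightarrow> Q 1 (R(R a := R b))"
  unfolding wp_def by (auto elim!: exec_elims intro!: exI exec.intros)

lemma wp_Seq [simp]: "wp (Seq p q) Q R \<longleftrightarrow> wp p (\<lambda>t. wp q (\<lambda>u. Q (t + u))) R"
  unfolding wp_def by (blast elim: exec_elims intro: exec.Seq)

lemma wp_IfPos [simp]:
  "wp (IfPos a p q) Q R \<longleftrightarrow> (if R a > 0 then wp p (\<lambda>t. Q (1 + t)) R else wp q (\<lambda>t. Q (1 + t)) R)"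
proof -
  have "exec (IfPos a p q) R t R' \<longleftrightarrow> (\<exists>u. t = 1 + u \<and> exec (if R a > 0 then p else q) R u R')" for t R'
  proof (cases "R a > 0")
    case True
    then have "\<exists>u. t = 1 + u \<and> exec p R u R'" if "exec (IfPos a p q) R t R'"
      using that by (elim exec_elims) auto
    with True exec.IfTrue[of R a p _ R' q] show ?thesis by auto
  next
    case False
    then have "\<exists>u. t = 1 + u \<and> exec q R u R'" if "exec (IfPos a p q) R t R'"
      using that by (elim exec_elims) auto
    with False exec.IfFalse[of R a q _ R' p] show ?thesis by auto
  qed
  then show ?thesis unfolding wp_def by auto
qed

text \<open>The ghost state \<open>g\<close> carries a potential that pays for the iterations still to come.\<close>

lemma wp_WhilePos:
  fixes pot :: "'g \<Rightarrow> nat"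
  assumes "I g R"
    and step: "\<And>g R. I g R \<Longrightarrow> R a > 0 \<Longrightarrow> wp p (\<lambda>t R'. \<exists>g'. I g' R' \<and> 1 + t + pot g' \<le> pot g) R"
  shows "wp (WhilePos a p) (\<lambda>t R'. t \<le> pot g + 1 \<and> (\<exists>g'. I g' R' \<and> \<not> R' a > 0)) R"
  using assms(1)
proof (induction "pot g" arbitrary: g R rule: less_induct)
  case less
  show ?case
  proof (cases "R a > 0")
    case False
    with less.prems exec.WhileFalse[of R a p] show ?thesis
      unfolding wp_def by (intro exI[of _ 1] exI[of _ R]) auto
  next
    case True
    from step[OF less.prems True] obtain t R' g'
      where 1: "exec p R t R'" "I g' R'" "1 + t + pot g' \<le> pot g"
      unfolding wp_def by blast
    \<comment> \<open>The loop test alone costs one step, so the potential drops strictly, as the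
      induction requires.\<close>
    from less.hyps[OF _ 1(2)] 1(3) obtain u R''
      where 2: "exec (WhilePos a p) R' u R''" "u \<le> pot g' + 1" "\<exists>g'. I g' R'' \<and> \<not> R'' a > 0"
      unfolding wp_def by auto
    from exec.WhileTrue[of R a p, OF True 1(1) 2(1)] 1(3) 2(2,3) show ?thesis
      unfolding wp_def by (intro exI[of _ "1 + t + u"] exI[of _ R'']) auto
  qed
qed

text \<open>Iteration over the positions of the fixed equation is unrolled when the program is
  built, so the \<open>i\<close>-th copy may contain a coefficient or a register number depending on
  \<open>i\<close>.\<close>

primrec rep :: "(nat \<Rightarrow> com) \<Rightarrow> nat \<Rightarrow> com" where
  "rep f 0 = Skip"
| "rep f (Suc n) = Seq (rep f n) (f n)"

lemma wp_rep:
  assumes "I 0 R"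
    and "\<And>i R. i < n \<Longrightarrow> I i R \<Longrightarrow> wp (f i) (\<lambda>t R'. t \<le> B \<and> I (Suc i) R') R"
  shows "wp (rep f n) (\<lambda>t R'. t \<le> 1 + n * B \<and> I n R') R"
  using assms(2)
proof (induction n)
  case 0
  with assms(1) show ?case by simp
next
  case (Suc n)
  have "wp (rep f n) (\<lambda>t R'. t \<le> 1 + n * B \<and> I n R') R"
    by (rule Suc.IH) (use Suc.prems in auto)
  then show ?case
    unfolding rep.simps wp_Seq
  proof (rule wp_conseq)
    fix t R' assume *: "t \<le> 1 + n * B \<and> I n R'"
    with Suc.prems[of n R'] have "wp (f n) (\<lambda>t R'. t \<le> B \<and> I (Suc n) R') R'" by simp
    then show "wp (f n) (\<lambda>u R'. t + u \<le> 1 + Suc n * B \<and> I (Suc n) R') R'"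
      by (rule wp_conseq) (use * in auto)
  qed
qed

section \<open>Memory layout\<close>

text \<open>The input occupies registers \<open>0, \<dots>, n\<close> and a work queue the registers beyond \<open>n\<close>. All
  auxiliary registers are negative.\<close>

abbreviation (input) "rOne \<equiv> - 1 :: int"
abbreviation (input) "rK \<equiv> - 2 :: int"
abbreviation (input) "rHead \<equiv> - 3 :: int"
abbreviation (input) "rTail \<equiv> - 4 :: int"
abbreviation (input) "rAns \<equiv> - 5 :: int"
abbreviation (input) "rGo \<equiv> - 6 :: int"
abbreviation (input) "rPos \<equiv> - 7 :: int"
abbreviation (input) "rVal \<equiv> - 8 :: int"
abbreviation (input) "rPow \<equiv> - 9 :: int"
abbreviation (input) "rTmp \<equiv> - 10 :: int"
abbreviation (input) "rNeg \<equiv> - 11 :: int"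
abbreviation (input) "rDiff \<equiv> - 12 :: int"
abbreviation (input) "rNT \<equiv> - 13 :: int"
abbreviation (input) "rFound \<equiv> - 14 :: int"
abbreviation (input) "rPtr \<equiv> - 15 :: int"
abbreviation (input) "rCnt \<equiv> - 16 :: int"
abbreviation (input) "rDst \<equiv> - 17 :: int"
abbreviation (input) "rElem \<equiv> - 18 :: int"
abbreviation (input) "rSign \<equiv> - 19 :: int"

text \<open>Four unbounded families, interleaved modulo 4 and lying below the scalar registers,
  hence all disjoint. For position \<open>i\<close> they hold the current value, the read pointer,
  the number of values still to try, and the entry of a violation found.\<close>

definition xreg :: "nat \<Rightarrow> int" where "xreg i = - 20 - 4 * int i"
definition preg :: "nat \<Rightarrow> int" where "preg i = - 21 - 4 * int i"
definition nreg :: "nat \<Rightarrow> int" where "nreg i = - 22 - 4 * int i"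
definition yreg :: "nat \<Rightarrow> int" where "yreg i = - 23 - 4 * int i"

lemma reg_neq [simp]:
  "- 20 < a \<Longrightarrow> xreg i \<noteq> a" "- 20 < a \<Longrightarrow> a \<noteq> xreg i"
  "- 20 < a \<Longrightarrow> preg i \<noteq> a" "- 20 < a \<Longrightarrow> a \<noteq> preg i"
  "- 20 < a \<Longrightarrow> nreg i \<noteq> a" "- 20 < a \<Longrightarrow> a \<noteq> nreg i"
  "- 20 < a \<Longrightarrow> yreg i \<noteq> a" "- 20 < a \<Longrightarrow> a \<noteq> yreg i"
  by (auto simp: xreg_def preg_def nreg_def yreg_def)

lemma reg_inj [simp]:
  "xreg i = xreg j \<longleftrightarrow> i = j" "preg i = preg j \<longleftrightarrow> i = j"
  "nreg i = nreg j \<longleftrightarrow> i = j" "yreg i = yreg j \<longleftrightarrow> i = j"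
  by (auto simp: xreg_def preg_def nreg_def yreg_def)

lemma reg_disj [simp]:
  "xreg i \<noteq> preg j" "xreg i \<noteq> nreg j" "xreg i \<noteq> yreg j"
  "preg i \<noteq> xreg j" "preg i \<noteq> nreg j" "preg i \<noteq> yreg j"
  "nreg i \<noteq> xreg j" "nreg i \<noteq> preg j" "nreg i \<noteq> yreg j"
  "yreg i \<noteq> xreg j" "yreg i \<noteq> preg j" "yreg i \<noteq> nreg j"
  unfolding xreg_def preg_def nreg_def yreg_def by presburger+

lemma yreg_less [simp]: "- 20 \<le> a \<Longrightarrow> yreg i < a"
  by (simp add: yreg_def)

lemma reg_range [simp]:
  "- 20 < a \<Longrightarrow> a \<notin> range yreg"
  "xreg i \<notin> range yreg" "preg i \<notin> range yreg" "nreg i \<notin> range yreg"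
  by (auto simp: image_iff)

section \<open>Contiguous memory segments\<close>

primrec seg :: "memory \<Rightarrow> int \<Rightarrow> int list \<Rightarrow> bool" where
  "seg R a [] \<longleftrightarrow> True"
| "seg R a (x # L) \<longleftrightarrow> R a = x \<and> seg R (a + 1) L"

lemma seg_append [simp]: "seg R a (L @ L') \<longleftrightarrow> seg R a L \<and> seg R (a + int (length L)) L'"
  by (induction L arbitrary: a) (auto simp: algebra_simps)

lemma seg_cong:
  "(\<And>b. a \<le> b \<Longrightarrow> b < a + int (length L) \<Longrightarrow> R' b = R b) \<Longrightarrow> seg R' a L = seg R a L"
proof (induction L arbitrary: a)
  case (Cons x L)
  have "seg R' (a + 1) L = seg R (a + 1) L" by (rule Cons.IH) (use Cons.prems in auto)
  with Cons.prems[of a] show ?case by simp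
qed simp

lemma seg_upd [simp]: "b < a \<or> a + int (length L) \<le> b \<Longrightarrow> seg (R(b := v)) a L = seg R a L"
  by (rule seg_cong) auto

lemma seg_nth: "(\<And>i. i < length L \<Longrightarrow> R (a + int i) = L ! i) \<Longrightarrow> seg R a L"
proof (induction L arbitrary: a)
  case (Cons x L)
  have "seg R (a + 1) L"
  proof (rule Cons.IH)
    fix i assume "i < length L"
    with Cons.prems[of "Suc i"] show "R (a + 1 + int i) = L ! i" by (simp add: algebra_simps)
  qed
  with Cons.prems[of 0] show ?case by simp
qed simp

section \<open>Decoding the input\<close>

fun val :: "bool list \<Rightarrow> nat" where
  "val [] = 0"
| "val (b # bs) = of_bool b + 2 * val bs"

lemma val_bits [simp]: "val (bits n) = n"
  by (induction n rule: bits.induct) (subst bits.simps, auto)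

text \<open>Separates the self-delimiting format from the number, so that the decoder's invariant
  can speak about the digits not yet read.\<close>

definition digits :: "bool list \<Rightarrow> bool list" where
  "digits bs = concat (map (\<lambda>b. [True, b]) bs) @ [False]"

lemma digits_simps [simp]:
  "digits [] = [False]" "digits (b # bs) = True # b # digits bs"
  by (simp_all add: digits_def)

lemma encode_nat_digits: "encode_nat n = digits (bits n)"
  by (simp add: encode_nat_def digits_def)

definition decode_body :: com where
  "decode_body = Seq (Add rPos rPos rOne) (Seq (Load rTmp rPos)
    (Seq (IfPos rTmp (Add rVal rVal rPow) Skip) (Seq (Add rPow rPow rPow)
    (Seq (Add rPos rPos rOne) (Load rTmp rPos)))))"

definition decode :: com where
  "decode = Seq (Const rVal 0) (Seq (Const rPow 1) (Seq (Load rTmp rPos)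
    (Seq (WhilePos rTmp decode_body) (Add rPos rPos rOne))))"

lemma wp_decode:
  assumes R: "R rOne = 1" "R rPos > 0" "seg R (R rPos) (map of_bool (encode_nat v))"
    and Q: "\<And>t R'. t \<le> 10 * length (encode_nat v) \<Longrightarrow> R' rVal = int v \<Longrightarrow>
      R' rPos = R rPos + int (length (encode_nat v)) \<Longrightarrow>
      (\<forall>a. a \<notin> {rPos, rVal, rPow, rTmp} \<longrightarrow> R' a = R a) \<Longrightarrow> Q t R'"
  shows "wp decode Q R"
proof -
  \<comment> \<open>With \<open>bs\<close> unread, \<open>rVal\<close> is the value of the digits
    consumed and \<open>rPow\<close> the place value of the next one. \<open>rTmp\<close> caches the
    marker bit at the current position, which the loop tests.\<close>
  define I where "I = (\<lambda>bs R'. (\<forall>a. a \<notin> {rPos, rVal, rPow, rTmp} \<longrightarrow> R' a = R a) \<and>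
    R' rVal + R' rPow * int (val bs) = int v \<and> R' rPos > 0 \<and>
    seg R' (R' rPos) (map of_bool (digits bs)) \<and> R' rTmp = R' (R' rPos) \<and>
    R' rPos + int (length (digits bs)) = R rPos + int (length (encode_nat v)))"
  let ?R = "R(rVal := 0, rPow := 1, rTmp := R (R rPos))"
  have "wp (WhilePos rTmp decode_body)
     (\<lambda>t R'. t \<le> 10 * length (bits v) + 1 \<and> (\<exists>bs. I bs R' \<and> \<not> R' rTmp > 0)) ?R"
  proof (rule wp_WhilePos[where I = I and pot = "\<lambda>bs. 10 * length bs"])
    show "I (bits v) ?R"
      unfolding I_def using R by (auto simp: encode_nat_digits)
  next
    fix bs R1 assume I: "I bs R1" and pos: "R1 rTmp > 0"
    then obtain b bs' where bs: "bs = b # bs'" by (cases bs) (auto simp: I_def)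
    show "wp decode_body (\<lambda>t R'. \<exists>g'. I g' R' \<and> 1 + t + 10 * length g' \<le> 10 * length bs) R1"
      unfolding decode_body_def
      using I pos R unfolding bs
      by (auto simp: I_def algebra_simps intro!: exI[of _ bs'])
  qed
  then show ?thesis
    unfolding decode_def
    using R(2)
    apply (simp del: fun_upd_apply add: fun_upd_other)
    apply (erule wp_conseq)
    apply clarsimp
    apply (rule Q)
    subgoal by (simp add: encode_nat_digits digits_def length_concat o_def sum_list_triv)
    subgoal for t R' bs by (cases bs) (auto simp: I_def R)
    subgoal for t R' bs by (cases bs) (auto simp: I_def R)
    subgoal for t R' bs by (auto simp: I_def)
    done
qed

section \<open>Finding a nontrivial solution\<close>

text \<open>Negates \<open>a\<close> as \<open>a - a - a\<close>, so that no register holding 0 is needed; \<open>Skip\<close> makes all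
  branches equally long.\<close>

definition if_zero :: "int \<Rightarrow> com \<Rightarrow> com \<Rightarrow> com" where
  "if_zero a p q = Seq (Sub rNeg a a) (Seq (Sub rNeg rNeg a)
     (IfPos a (Seq Skip q) (IfPos rNeg q p)))"

lemma wp_if_zero [simp]:
  "a \<noteq> rNeg \<Longrightarrow> wp (if_zero a p q) Q R \<longleftrightarrow>
     (if R a = 0 then wp p (\<lambda>t. Q (t + 4)) (R(rNeg := - R a))
      else wp q (\<lambda>t. Q (t + 4)) (R(rNeg := - R a)))"
  by (auto simp: if_zero_def eval_nat_numeral)

text \<open>The machine cannot multiply, but \<open>z\<close> is a constant of the program, so
  repeated addition or subtraction takes a number of steps independent of the input.\<close>

definition add_multiple :: "int \<Rightarrow> int \<Rightarrow> int \<Rightarrow> com" where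
  "add_multiple z a b = rep (\<lambda>_. if z \<ge> 0 then Add b b a else Sub b b a) (nat \<bar>z\<bar>)"

lemma wp_add_multiple [simp]:
  assumes "a \<noteq> b"
  shows "wp (add_multiple z a b) Q R \<longleftrightarrow> Q (nat \<bar>z\<bar> + 1) (R(b := R b + z * R a))"
proof -
  have "wp (rep (\<lambda>_. Add b b a) n) Q R \<longleftrightarrow> Q (n + 1) (R(b := R b + int n * R a))" for n Q R
    using assms by (induction n arbitrary: Q) (auto simp: algebra_simps)
  moreover have "wp (rep (\<lambda>_. Sub b b a) n) Q R \<longleftrightarrow> Q (n + 1) (R(b := R b - int n * R a))" for n Q R
    using assms by (induction n arbitrary: Q) (auto simp: algebra_simps)
  ultimately show ?thesis by (simp add: add_multiple_def)
qed

text \<open>In any witnessing partition \<open>x\<close> is constant on each class, so a level set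
  is a disjoint union of classes and its coefficient sum is a sum of zeros. Conversely, the level
  sets themselves form a partition of the required kind.\<close>

lemma trivial_solution_iff:
  "trivial_solution c x \<longleftrightarrow> (\<forall>i<length c. (\<Sum>j | j < length c \<and> x ! j = x ! i. c ! j) = 0)"
  (is "_ \<longleftrightarrow> ?R")
proof
  assume "trivial_solution c x"
  then obtain \<P> where P: "partition_on {..<length c} \<P>"
    "\<And>P. P \<in> \<P> \<Longrightarrow> (\<forall>i\<in>P. \<forall>j\<in>P. x ! i = x ! j) \<and> (\<Sum>i\<in>P. c ! i) = 0"
    unfolding trivial_solution_def by blast
  show ?R
  proof (intro allI impI)
    fix i assume "i < length c"
    let ?L = "{j. j < length c \<and> x ! j = x ! i}"
    let ?B = "{P \<in> \<P>. P \<subseteq> ?L}"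
    have "\<Union> ?B = ?L"
    proof (intro equalityI subsetI)
      fix j assume j: "j \<in> ?L"
      with partition_onD1[OF P(1)] obtain P where "P \<in> \<P>" "j \<in> P" by auto
      moreover from this have "P \<subseteq> {..<length c}" "\<forall>k\<in>P. x ! k = x ! j"
        using partition_onD1[OF P(1)] P(2) by blast+
      ultimately show "j \<in> \<Union> ?B" using j by fastforce
    qed auto
    moreover have "sum ((!) c) (\<Union> ?B) = (\<Sum>P\<in>?B. \<Sum>j\<in>P. c ! j)"
    proof -
      have "\<forall>P\<in>?B. finite P" by (auto intro: finite_subset[of _ "{..<length c}"])
      moreover have "\<forall>P\<in>?B. \<forall>P'\<in>?B. P \<noteq> P' \<longrightarrow> P \<inter> P' = {}"
        using partition_onD2[OF P(1)] by (auto simp: disjoint_def)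
      ultimately show ?thesis by (simp add: sum.Union_disjoint)
    qed
    moreover have "(\<Sum>P\<in>?B. \<Sum>j\<in>P. c ! j) = 0"
      by (rule sum.neutral) (use P(2) in blast)
    ultimately show "(\<Sum>j\<in>?L. c ! j) = 0" by simp
  qed
next
  assume R: ?R
  let ?P = "(\<lambda>i. {j. j < length c \<and> x ! j = x ! i}) ` {..<length c}"
  have "partition_on {..<length c} ?P"
    by (rule partition_onI) (auto simp: disjnt_def)
  with R show "trivial_solution c x"
    unfolding trivial_solution_def by (intro exI[of _ ?P]) auto
qed

section \<open>Testing a single tuple\<close>

context
  fixes c :: "int list" and d :: int
begin

definition violation :: "int list \<Rightarrow> bool" where
  "violation x \<longleftrightarrow> is_solution c d x \<and> \<not> trivial_solution c x"

definition xs_of :: "memory \<Rightarrow> int list" where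
  "xs_of R = map (\<lambda>i. R (xreg i)) [0..<length c]"

definition ys_of :: "memory \<Rightarrow> int list" where
  "ys_of R = map (\<lambda>i. R (yreg i)) [0..<length c]"

text \<open>\<open>rTmp\<close> collects the coefficients on the level set of position
  \<open>i\<close>. Since \<open>rNT\<close> is only ever set to 1 here, running this for all
  \<open>i\<close> computes a disjunction, namely nontriviality.\<close>

definition level :: "nat \<Rightarrow> com" where
  "level i = Seq (Const rTmp 0) (Seq
     (rep (\<lambda>j. Seq (Sub rDiff (xreg i) (xreg j))
        (if_zero rDiff (Seq (Const rVal (c ! j)) (Add rTmp rTmp rVal)) Skip)) (length c))
     (if_zero rTmp Skip (Const rNT 1)))"

text \<open>A register is copied by adding a zero, produced as \<open>rTmp - rTmp\<close>.\<close>

definition copy_tuple :: com where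
  "copy_tuple = Seq (Const rFound 1) (rep (\<lambda>i. Seq (Sub rTmp rTmp rTmp) (Add (yreg i) (xreg i) rTmp)) (length c))"

text \<open>Starting \<open>rTmp\<close> at \<open>- d\<close> turns the equation into a comparison
  with 0.\<close>

definition check :: com where
  "check = Seq (Const rNT 0) (Seq (rep level (length c)) (Seq (Const rTmp (- d))
     (Seq (rep (\<lambda>i. add_multiple (c ! i) (xreg i) rTmp) (length c))
     (IfPos rNT (if_zero rTmp copy_tuple Skip) Skip))))"

lemma wp_level:
  assumes "i < length c"
  shows "wp (level i) (\<lambda>t R'. t \<le> 10 * length c + 10 \<and>
    (\<forall>a. a \<notin> {rTmp, rVal, rDiff, rNeg, rNT} \<longrightarrow> R' a = R a) \<and>
    R' rNT = (if (\<Sum>j | j < length c \<and> R (xreg j) = R (xreg i). c ! j) = 0 then R rNT else 1)) R"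
proof -
  define I where "I = (\<lambda>n R'. (\<forall>a. a \<notin> {rTmp, rVal, rDiff, rNeg} \<longrightarrow> R' a = R a) \<and>
    R' rTmp = (\<Sum>j | j < n \<and> R (xreg j) = R (xreg i). c ! j))"
  have split: "{j. j < Suc n \<and> P j} = (if P n then insert n {j. j < n \<and> P j} else {j. j < n \<and> P j})" for n P
    by (auto simp: less_Suc_eq)
  have "wp (rep (\<lambda>j. Seq (Sub rDiff (xreg i) (xreg j))
        (if_zero rDiff (Seq (Const rVal (c ! j)) (Add rTmp rTmp rVal)) Skip)) (length c))
      (\<lambda>t R'. t \<le> 1 + length c * 10 \<and> I (length c) R') (R(rTmp := 0))"
    by (rule wp_rep) (auto simp: I_def split)
  then show ?thesis
    unfolding level_def by (auto elim!: wp_conseq simp: I_def)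
qed

lemma wp_copy_tuple:
  "wp copy_tuple (\<lambda>t R'. t \<le> 3 * length c + 3 \<and>
    (\<forall>a. a \<notin> insert rTmp (insert rFound (range yreg)) \<longrightarrow> R' a = R a) \<and>
    R' rFound = 1 \<and> ys_of R' = xs_of R) R"
proof -
  define I where "I = (\<lambda>n R'. (\<forall>a. a \<notin> insert rTmp (insert rFound (range yreg)) \<longrightarrow> R' a = R a) \<and>
    R' rFound = 1 \<and> (\<forall>i<n. R' (yreg i) = R (xreg i)))"
  have "wp (rep (\<lambda>i. Seq (Sub rTmp rTmp rTmp) (Add (yreg i) (xreg i) rTmp)) (length c))
      (\<lambda>t R'. t \<le> 1 + length c * 3 \<and> I (length c) R') (R(rFound := 1))"
    by (rule wp_rep) (auto simp: I_def less_Suc_eq)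
  then show ?thesis
    unfolding copy_tuple_def by (auto elim!: wp_conseq simp: I_def xs_of_def ys_of_def)
qed

text \<open>A generous bound depending on the equation only, thus a constant of the problem. The sum
  of absolute values bounds the cost of multiplying by any one coefficient.\<close>

definition check_time :: nat where
  "check_time = 30 + length c * (10 * length c + 20 + sum_list (map (\<lambda>z. nat \<bar>z\<bar>) c))"

text \<open>The loop over \<open>level\<close> decides nontriviality and the linear sum decides the
  equation. If the tuple is no violation, \<open>rFound\<close> and the \<open>yreg\<close> family
  keep their contents, so an earlier find survives later checks.\<close>

lemma wp_check:
  "wp check (\<lambda>t R'. t \<le> check_time \<and>
    (\<forall>a. a \<notin> {rTmp, rVal, rDiff, rNeg, rNT, rFound} \<union> range yreg \<longrightarrow> R' a = R a) \<and>
    (if violation (xs_of R) then R' rFound = 1 \<and> ys_of R' = xs_of R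
     else R' rFound = R rFound \<and> ys_of R' = ys_of R)) R"
proof -
  define F where "F = (\<lambda>R'. (\<forall>a. a \<notin> {rTmp, rVal, rDiff, rNeg, rNT} \<longrightarrow> R' a = R a))"
  define I where "I = (\<lambda>n R'. F R' \<and> R' rNT =
    of_bool (\<exists>i<n. (\<Sum>j | j < length c \<and> R (xreg j) = R (xreg i). c ! j) \<noteq> 0))"
  have 1: "wp (rep level (length c)) (\<lambda>t R'. t \<le> 1 + length c * (10 * length c + 10) \<and> I (length c) R')
      (R(rNT := 0))"
  proof (rule wp_rep)
    show "I 0 (R(rNT := 0))" by (simp add: I_def F_def)
  next
    fix i R1 assume "i < length c" and I: "I i R1"
    show "wp (level i) (\<lambda>t R'. t \<le> 10 * length c + 10 \<and> I (Suc i) R') R1"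
      by (rule wp_conseq, rule wp_level, fact) (use I in \<open>auto simp: I_def F_def less_Suc_eq\<close>)
  qed
  define J where "J = (\<lambda>n R'. F R' \<and> R' rNT = of_bool (\<not> trivial_solution c (xs_of R)) \<and>
    R' rTmp = (\<Sum>i<n. c ! i * R (xreg i)) - d)"
  let ?s = "sum_list (map (\<lambda>z. nat \<bar>z\<bar>) c)"
  have 2: "wp (rep (\<lambda>i. add_multiple (c ! i) (xreg i) rTmp) (length c))
     (\<lambda>t R'. t \<le> 1 + length c * (1 + ?s) \<and> J (length c) R') (R1(rTmp := - d))"
    if "I (length c) R1" for R1
  proof (rule wp_rep)
    have eq: "{j. j < length c \<and> xs_of R ! j = xs_of R ! i} = {j. j < length c \<and> R (xreg j) = R (xreg i)}"
      if "i < length c" for i using that by (auto simp: xs_of_def)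
    show "J 0 (R1(rTmp := - d))"
      using that by (auto simp: J_def I_def F_def trivial_solution_iff eq)
  next
    fix i R1 assume i: "i < length c" and J: "J i R1"
    have "nat \<bar>c ! i\<bar> \<le> ?s" using i by (intro member_le_sum_list) auto
    then show "wp (add_multiple (c ! i) (xreg i) rTmp) (\<lambda>t R'. t \<le> 1 + ?s \<and> J (Suc i) R') R1"
      using J by (simp add: J_def F_def)
  qed
  have viol: "violation (xs_of R) \<longleftrightarrow> (\<Sum>i<length c. c ! i * R (xreg i)) = d \<and> \<not> trivial_solution c (xs_of R)"
    by (auto simp: violation_def is_solution_def xs_of_def)
  have 3: "wp (IfPos rNT (if_zero rTmp copy_tuple Skip) Skip) (\<lambda>t R'. t \<le> 3 * length c + 8 \<and>
    (\<forall>a. a \<notin> {rTmp, rVal, rDiff, rNeg, rNT, rFound} \<union> range yreg \<longrightarrow> R' a = R a) \<and>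
    (if violation (xs_of R) then R' rFound = 1 \<and> ys_of R' = xs_of R
     else R' rFound = R rFound \<and> ys_of R' = ys_of R)) R2" if J: "J (length c) R2" for R2
  proof (cases "violation (xs_of R)")
    case True
    have "xs_of (R2(rNeg := v)) = xs_of R" for v using J by (simp add: J_def F_def xs_of_def)
    with J True wp_copy_tuple show ?thesis
      by (auto simp: viol J_def F_def intro!: wp_conseq[OF wp_copy_tuple])
  next
    case False
    have "ys_of (R2(rNeg := v)) = ys_of R" "ys_of R2 = ys_of R" for v
      using J by (simp_all add: J_def F_def ys_of_def)
    with J False show ?thesis by (auto simp: viol J_def F_def)
  qed
  show ?thesis
    unfolding check_def wp_Seq wp_simps
    apply (rule wp_conseq[OF 1], clarify)
    apply (rule wp_conseq[OF 2], assumption, clarify)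
    apply (rule wp_conseq[OF 3], assumption)
    apply (auto simp: check_time_def algebra_simps)
    done
qed

section \<open>Enumerating all tuples over a set\<close>

text \<open>The register \<open>rFound\<close> tells whether one of the tuples in \<open>X\<close> is a violation; if so, the
  registers \<open>yreg\<close> hold some violation over \<open>s\<close>.\<close>

definition searched :: "int list \<Rightarrow> int list set \<Rightarrow> memory \<Rightarrow> bool" where
  "searched s X R \<longleftrightarrow> R rFound = 0 \<and> (\<forall>x\<in>X. \<not> violation x) \<or>
     R rFound = 1 \<and> violation (ys_of R) \<and> set (ys_of R) \<subseteq> set s"

text \<open>What \<open>search i\<close> covers while the enclosing loops hold the positions from
  \<open>i\<close> on fixed: the current tuple alone for \<open>i = 0\<close>, all tuples over
  \<open>s\<close> for \<open>i = length c\<close>.\<close>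

definition tuples :: "int list \<Rightarrow> nat \<Rightarrow> memory \<Rightarrow> int list set" where
  "tuples s i R = {x. length x = length c \<and> (\<forall>j<i. j < length c \<longrightarrow> x ! j \<in> set s) \<and>
     (\<forall>j. i \<le> j \<longrightarrow> j < length c \<longrightarrow> x ! j = R (xreg j))}"

lemma searched_upd [simp]:
  "a \<noteq> rFound \<Longrightarrow> a \<notin> range yreg \<Longrightarrow> searched s X (R(a := v)) \<longleftrightarrow> searched s X R"
proof -
  assume "a \<noteq> rFound" "a \<notin> range yreg"
  moreover from this have "ys_of (R(a := v)) = ys_of R" by (auto simp: ys_of_def)
  ultimately show ?thesis by (simp add: searched_def)
qed

text \<open>Nested loops, one per position, generated by recursion. Each runs over the block at
  \<open>rHead\<close> with a pointer and a counter of its own; the enumeration is not cut short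
  after a find.\<close>

primrec search :: "nat \<Rightarrow> com" where
  "search 0 = check"
| "search (Suc i) = Seq (Add (preg i) rHead rOne) (Seq (Load (nreg i) rHead)
     (WhilePos (nreg i) (Seq (Load (xreg i) (preg i)) (Seq (search i)
       (Seq (Add (preg i) (preg i) rOne) (Sub (nreg i) (nreg i) rOne))))))"

lemma all_ge_conv: "(\<forall>j. i \<le> j \<longrightarrow> P j) \<longleftrightarrow> P i \<and> (\<forall>j. Suc i \<le> j \<longrightarrow> P j)" for i :: nat
  by (metis Suc_leD Suc_leI le_neq_implies_less order_refl)

text \<open>The set \<open>X\<close> of tuples checked earlier is a parameter so that successive
  runs of the inner search can be chained. The registers of positions from \<open>i\<close> on are
  preserved because the enclosing loops rely on them.\<close>

lemma wp_search:
  assumes "i \<le> length c" "R rOne = 1" "R rHead > 0" "seg R (R rHead) (int (length s) # s)"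
    and "searched s X R" "\<And>j. i \<le> j \<Longrightarrow> j < length c \<Longrightarrow> R (xreg j) \<in> set s"
  shows "wp (search i) (\<lambda>t R'. t \<le> (check_time + 10) * (5 * length s + 5) ^ i \<and>
     (\<forall>a > rPos. R' a = R a) \<and>
     (\<forall>j \<ge> i. R' (xreg j) = R (xreg j) \<and> R' (preg j) = R (preg j) \<and> R' (nreg j) = R (nreg j)) \<and>
     searched s (X \<union> tuples s i R) R') R"
  using assms
proof (induction i arbitrary: R X)
  case 0
  have "tuples s 0 R = {xs_of R}"
    by (auto simp: tuples_def xs_of_def intro!: nth_equalityI)
  moreover have "set (xs_of R) \<subseteq> set s" using 0 by (auto simp: xs_of_def)
  ultimately show ?case
    unfolding search.simps
    by (intro wp_conseq[OF wp_check]) (use 0 in \<open>auto simp: searched_def split: if_splits\<close>)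
next
  case (Suc i)
  let ?m = "length s" and ?T = "(check_time + 10) * (5 * length s + 5) ^ i"
  \<comment> \<open>The tuples done once position \<open>i\<close> has run through the initial part
    \<open>u\<close> of \<open>s\<close>.\<close>
  define Y where "Y = (\<lambda>u. {x \<in> tuples s (Suc i) R. x ! i \<in> set u})"
  define F where "F = (\<lambda>R'. (\<forall>a > rPos. R' a = R a) \<and>
     (\<forall>j > i. R' (xreg j) = R (xreg j) \<and> R' (preg j) = R (preg j) \<and> R' (nreg j) = R (nreg j)))"
  define I where "I = (\<lambda>(u, v) R'. s = u @ v \<and> F R' \<and> R' (nreg i) = int (length v) \<and>
     R' (preg i) = R rHead + 1 + int (length u) \<and> searched s (X \<union> Y u) R')"
  let ?body = "Seq (Load (xreg i) (preg i)) (Seq (search i)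
       (Seq (Add (preg i) (preg i) rOne) (Sub (nreg i) (nreg i) rOne)))"
  let ?R0 = "R(preg i := R rHead + 1, nreg i := int ?m)"
  have "wp (WhilePos (nreg i) ?body) (\<lambda>t R'. t \<le> length (snd ([] :: int list, s)) * (?T + 4) + 1 \<and>
    (\<exists>g'. I g' R' \<and> \<not> R' (nreg i) > 0)) ?R0"
  \<comment> \<open>One iteration costs the inner search, three instructions and the test.\<close>
  proof (rule wp_WhilePos[where pot = "\<lambda>g. length (snd g) * (?T + 4)" and I = I and g = "([], s)"])
    show "I ([], s) ?R0"
      using Suc.prems by (auto simp: I_def F_def Y_def)
  next
    fix g R1 assume I: "I g R1" and pos: "R1 (nreg i) > 0"
    obtain u e v where g: "g = (u, e # v)" using I pos
      by (cases g; cases "snd g") (auto simp: I_def)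
    have s: "s = u @ e # v" and F: "F R1" and cnt: "R1 (nreg i) = int (length (e # v))"
      and ptr: "R1 (preg i) = R rHead + 1 + int (length u)" and srch: "searched s (X \<union> Y u) R1"
      using I unfolding I_def g prod.case by blast+
    have e: "R1 (R1 (preg i)) = e"
    proof -
      have "R (R rHead + 1 + int (length u)) = e"
        using Suc.prems(4) by (simp add: s algebra_simps)
      with F ptr Suc.prems(3) show ?thesis by (simp add: F_def)
    qed
    let ?R2 = "R1(xreg i := e)"
    have fr: "R1 a = R a" if "a > rPos" for a using that F by (auto simp: F_def)
    have IH: "wp (search i) (\<lambda>t R'. t \<le> ?T \<and>
       (\<forall>a > rPos. R' a = ?R2 a) \<and>
       (\<forall>j \<ge> i. R' (xreg j) = ?R2 (xreg j) \<and> R' (preg j) = ?R2 (preg j) \<and> R' (nreg j) = ?R2 (nreg j)) \<and>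
       searched s ((X \<union> Y u) \<union> tuples s i ?R2) R') ?R2"
    proof (rule Suc.IH)
      show "i \<le> length c" "?R2 rOne = 1" "?R2 rHead > 0" using Suc.prems fr by auto
      have "seg ?R2 (R rHead) (int (length s) # s) = seg R (R rHead) (int (length s) # s)"
        by (rule seg_cong) (use Suc.prems(3) fr in auto)
      with Suc.prems(4) fr show "seg ?R2 (?R2 rHead) (int (length s) # s)" by simp
      show "searched s (X \<union> Y u) ?R2" using srch by simp
      show "?R2 (xreg j) \<in> set s" if "i \<le> j" "j < length c" for j
      proof (cases "j = i")
        case False
        with that have "R1 (xreg j) = R (xreg j)" using F by (auto simp: F_def)
        with Suc.prems(6)[of j] False that show ?thesis by simp
      qed (simp add: s)
    qed
    have Y: "Y u \<union> tuples s i ?R2 = Y (u @ [e])"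
    proof -
      have "R1 (xreg j) = R (xreg j)" if "i < j" for j using that F by (auto simp: F_def)
      then have "x \<in> tuples s i ?R2 \<longleftrightarrow> x \<in> tuples s (Suc i) R \<and> x ! i = e" for x
        using Suc.prems(1) s by (simp add: tuples_def All_less_Suc all_ge_conv[of i]) (auto simp: Suc_le_eq)
      then show ?thesis by (auto simp: Y_def)
    qed
    show "wp ?body (\<lambda>t R'. \<exists>g'. I g' R' \<and> 1 + t + length (snd g') * (?T + 4)
        \<le> length (snd g) * (?T + 4)) R1"
      unfolding wp_Seq wp_simps e
    proof (rule wp_conseq[OF IH], intro exI[of _ "(u @ [e], v)"] conjI, goal_cases)
      case (1 t R')
      then have R': "R' a = R a" if "a > rPos" for a using that fr by simp
      let ?M = "R'(preg i := R' (preg i) + R' rOne, nreg i := R' (nreg i) - R' rOne)"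
      have M: "R'(preg i := R' (preg i) + R' rOne, nreg i := (R'(preg i := R' (preg i) + R' rOne)) (nreg i)
          - (R'(preg i := R' (preg i) + R' rOne)) rOne) = ?M" by simp
      have "F ?M" using 1 F by (simp add: F_def)
      moreover have "searched s (X \<union> Y (u @ [e])) ?M"
        using 1 by (simp add: Un_assoc Y)
      ultimately show ?case
        unfolding I_def prod.case M using 1 cnt ptr R'[of rOne] Suc.prems(2)
        by (simp add: s)
    next
      case (2 t R')
      then show ?case by (simp add: g)
    qed
  qed
  then have W: "wp (WhilePos (nreg i) ?body) (\<lambda>t R'. t \<le> ?m * (?T + 4) + 1 \<and>
    (\<exists>g'. I g' R' \<and> \<not> R' (nreg i) > 0)) ?R0" by simp
  have Y: "Y s = tuples s (Suc i) R"
    using Suc.prems(1) by (auto simp: Y_def tuples_def All_less_Suc)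
  \<comment> \<open>Since \<open>?T\<close> is positive, the base \<open>5 * ?m + 5\<close> absorbs
    both the overhead per iteration and the set-up of the loop.\<close>
  have time: "?m * (?T + 4) + 4 \<le> (check_time + 10) * (5 * ?m + 5) ^ Suc i"
  proof -
    have "m * (T + 4) + 4 \<le> (5 * m + 5) * T" if "T > 0" for m T :: nat
      using that by (cases T) (auto simp: algebra_simps)
    moreover have "?T > 0" by (simp add: check_time_def)
    ultimately have "?m * (?T + 4) + 4 \<le> (5 * ?m + 5) * ?T" by blast
    then show ?thesis by (simp add: mult_ac)
  qed
  have R0: "R(preg i := R rHead + R rOne, nreg i := (R(preg i := R rHead + R rOne)) ((R(preg i := R rHead + R rOne)) rHead)) = ?R0"
    using Suc.prems(2-4) by simp
  show ?case
    unfolding search.simps wp_Seq wp_simps R0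
  proof (rule wp_conseq[OF W], elim conjE exE, goal_cases)
    case (1 t R' g)
    then obtain v where "g = (s, v)" "F R'" "searched s (X \<union> Y s) R'"
      unfolding I_def by (cases g) auto
    with 1 time show ?case by (auto simp: F_def Y Suc_le_eq)
  qed
qed

section \<open>The branching step\<close>

text \<open>The length in front serves as loop bound and tells where the next block of the queue
  begins.\<close>

definition blk :: "int list \<Rightarrow> int list" where
  "blk s = int (length s) # s"

definition queue :: "int list list \<Rightarrow> int list" where
  "queue qs = concat (map blk qs)"

lemma queue_simps [simp]:
  "queue [] = []" "queue (s # qs) = blk s @ queue qs" "queue (qs @ qs') = queue qs @ queue qs'"
  by (simp_all add: queue_def)

lemma length_blk [simp]: "length (blk s) = Suc (length s)"
  by (simp add: blk_def)

section \<open>Generating the children of a set\<close>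

definition push_body :: "nat \<Rightarrow> com" where
  "push_body j = Seq (Load rElem rPtr) (Seq (Sub rDiff rElem (yreg j))
     (Seq (if_zero rDiff Skip (Seq (Store rDst rElem) (Add rDst rDst rOne)))
     (Seq (Add rPtr rPtr rOne) (Sub rCnt rCnt rOne))))"

text \<open>The length of the copy is unknown in advance, so its register at \<open>rTail\<close> is
  skipped at first and filled with \<open>rDst - rTail - 1\<close> after the copying loop.\<close>

definition push :: "nat \<Rightarrow> com" where
  "push j = Seq (Add rPtr rHead rOne) (Seq (Load rCnt rHead) (Seq (Add rDst rTail rOne)
     (Seq (WhilePos rCnt (push_body j))
     (Seq (Sub rDiff rDst rTail) (Seq (Sub rDiff rDiff rOne) (Seq (Store rTail rDiff)
     (Seq (Sub rElem rElem rElem) (Add rTail rDst rElem))))))))"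

abbreviation (input) "pushRegs \<equiv> {rTail, rDiff, rNeg, rPtr, rCnt, rDst, rElem}"

text \<open>Apart from the auxiliary registers, all writes happen at or above the old
  \<open>rTail\<close>, and the assumption \<open>tail\<close> puts the source block below it. Hence
  copying never disturbs what is still to be read.\<close>

lemma wp_push:
  assumes R: "R rOne = 1" "R rHead > 0" "seg R (R rHead) (blk s)"
    and tail: "R rHead + 1 + int (length s) \<le> R rTail"
  shows "wp (push j) (\<lambda>t R'. t \<le> 20 * length s + 20 \<and>
     R' rTail = R rTail + 1 + int (length (removeAll (R (yreg j)) s)) \<and>
     seg R' (R rTail) (blk (removeAll (R (yreg j)) s)) \<and>
     (\<forall>a < R rTail. a \<notin> pushRegs \<longrightarrow> R' a = R a)) R"
proof -
  define rem where "rem = removeAll (R (yreg j))"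
  define F where "F = (\<lambda>R'. (\<forall>a < R rTail. a \<notin> pushRegs - {rTail} \<longrightarrow> R' a = R a))"
  define I where "I = (\<lambda>(u, v) R'. s = u @ v \<and> F R' \<and> R' rCnt = int (length v) \<and>
     R' rPtr = R rHead + 1 + int (length u) \<and> R' rDst = R rTail + 1 + int (length (rem u)) \<and>
     seg R' (R rTail + 1) (rem u))"
  let ?R0 = "R(rPtr := R rHead + 1, rCnt := int (length s), rDst := R rTail + 1)"
  have W: "wp (WhilePos rCnt (push_body j)) (\<lambda>t R'. t \<le> 12 * length (snd ([] :: int list, s)) + 1 \<and>
    (\<exists>g'. I g' R' \<and> \<not> R' rCnt > 0)) ?R0"
  \<comment> \<open>An iteration takes 9 steps if the entry is dropped and 10 if it is copied, plus
    1 for the test.\<close>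
  proof (rule wp_WhilePos[where pot = "\<lambda>g. 12 * length (snd g)" and I = I and g = "([], s)"])
    show "I ([], s) ?R0" by (auto simp: I_def F_def rem_def)
  next
    fix g R1 assume I: "I g R1" and pos: "R1 rCnt > 0"
    obtain u e v where g: "g = (u, e # v)" using I pos
      by (cases g; cases "snd g") (auto simp: I_def)
    have s: "s = u @ e # v" and F: "F R1" and cnt: "R1 rCnt = int (length (e # v))"
      and ptr: "R1 rPtr = R rHead + 1 + int (length u)"
      and dst: "R1 rDst = R rTail + 1 + int (length (rem u))"
      and sg: "seg R1 (R rTail + 1) (rem u)"
      using I unfolding I_def g prod.case by blast+
    have e0: "R (R rHead + 1 + int (length u)) = e"
      using R(3) by (simp add: s blk_def algebra_simps)
    moreover have "R1 (R rHead + 1 + int (length u)) = R (R rHead + 1 + int (length u))"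
      using F R(2) tail s by (simp add: F_def)
    ultimately have e: "R1 (R1 rPtr) = e" by (simp add: ptr)
    have y: "R1 (yreg j) = R (yreg j)" and one: "R1 rOne = 1"
      using F R tail by (simp_all add: F_def)
    have "wp (push_body j) (\<lambda>t R'. I (u @ [e], v) R' \<and> t = (if e = R (yreg j) then 9 else 10)) R1"
    proof (cases "e = R (yreg j)")
      case True
      with e0 F cnt ptr dst sg one y R(2) tail show ?thesis
        unfolding push_body_def I_def by (simp add: e rem_def s) (simp add: F_def)
    next
      case False
      with e0 F cnt ptr dst sg one y R(2) tail show ?thesis
        unfolding push_body_def I_def by (simp add: e rem_def s) (simp add: F_def)
    qed
    then show "wp (push_body j) (\<lambda>t R'. \<exists>g'. I g' R' \<and> 1 + t + 12 * length (snd g')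
        \<le> 12 * length (snd g)) R1"
      by (rule wp_conseq, intro exI[of _ "(u @ [e], v)"]) (simp add: g)
  qed
  have R0: "(R(rPtr := R rHead + R rOne, rCnt := (R(rPtr := R rHead + R rOne)) ((R(rPtr := R rHead + R rOne)) rHead),
      rDst := (R(rPtr := R rHead + R rOne, rCnt := (R(rPtr := R rHead + R rOne)) ((R(rPtr := R rHead + R rOne)) rHead))) rTail +
      (R(rPtr := R rHead + R rOne, rCnt := (R(rPtr := R rHead + R rOne)) ((R(rPtr := R rHead + R rOne)) rHead))) rOne)) = ?R0"
    using R by (simp add: blk_def)
  show ?thesis
    unfolding push_def wp_Seq wp_simps R0
  proof (rule wp_conseq[OF W], elim conjE exE, goal_cases)
    case (1 t R' g)
    then have *: "F R'" "R' rDst = R rTail + 1 + int (length (rem s))" "seg R' (R rTail + 1) (rem s)"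
      unfolding I_def by (cases g; simp)+
    have "R' rTail = R rTail" "R' rOne = 1" using * R tail by (simp_all add: F_def)
    with * 1 R(2) tail show ?case by (simp add: blk_def F_def rem_def)
  qed
qed

text \<open>One child per position of the violation. Repeated values yield equal children, which
  keeps the branching degree fixed at \<open>length c\<close>.\<close>

definition push_all :: com where
  "push_all = rep push (length c)"

lemma wp_push_all:
  assumes R: "R rOne = 1" "R rHead > 0" "seg R (R rHead) (blk s)"
    and tail: "R rHead + 1 + int (length s) \<le> R rTail"
  defines "new \<equiv> queue (map (\<lambda>y. removeAll y s) (ys_of R))"
  shows "wp push_all (\<lambda>t R'. t \<le> 1 + length c * (20 * length s + 20) \<and>
     R' rTail = R rTail + int (length new) \<and> seg R' (R rTail) new \<and>
     (\<forall>a < R rTail. a \<notin> pushRegs \<longrightarrow> R' a = R a)) R"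
proof -
  define Q where "Q = (\<lambda>i. queue (map (\<lambda>j. removeAll (R (yreg j)) s) [0..<i]))"
  define I where "I = (\<lambda>i R'. R' rTail = R rTail + int (length (Q i)) \<and> seg R' (R rTail) (Q i) \<and>
     (\<forall>a < R rTail. a \<notin> pushRegs \<longrightarrow> R' a = R a))"
  have "wp push_all (\<lambda>t R'. t \<le> 1 + length c * (20 * length s + 20) \<and> I (length c) R') R"
    unfolding push_all_def
  proof (rule wp_rep)
    show "I 0 R" by (simp add: I_def Q_def)
  next
    fix i R1 assume I: "I i R1"
    have R1: "R1 rOne = 1" "R1 rHead = R rHead" "R1 (yreg i) = R (yreg i)"
      using I R tail by (simp_all add: I_def)
    have sg: "seg R1 (R rHead) (blk s)"
      using I R tail by (intro iffD2[OF seg_cong R(3)]) (simp add: I_def)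
    have "wp (push i) (\<lambda>t R'. t \<le> 20 * length s + 20 \<and>
     R' rTail = R1 rTail + 1 + int (length (removeAll (R1 (yreg i)) s)) \<and>
     seg R' (R1 rTail) (blk (removeAll (R1 (yreg i)) s)) \<and>
     (\<forall>a < R1 rTail. a \<notin> pushRegs \<longrightarrow> R' a = R1 a)) R1"
      by (rule wp_push) (use R1 sg R I tail in \<open>auto simp: I_def\<close>)
    then show "wp (push i) (\<lambda>t R'. t \<le> 20 * length s + 20 \<and> I (Suc i) R') R1"
    proof (rule wp_conseq, elim conjE, goal_cases)
      case (1 t R')
      have T1: "R1 rTail = R rTail + int (length (Q i))" using I by (simp add: I_def)
      have "seg R' (R rTail) (Q i)"
      proof (rule iffD2[OF seg_cong])
        show "seg R1 (R rTail) (Q i)" using I by (simp add: I_def)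
      qed (use 1 T1 R tail in auto)
      moreover have "Q (Suc i) = Q i @ blk (removeAll (R (yreg i)) s)" by (simp add: Q_def)
      ultimately show ?case using 1 T1 I R1(3) by (simp add: I_def)
    qed
  qed
  moreover have "Q (length c) = new" by (simp add: Q_def new_def ys_of_def o_def)
  ultimately show ?thesis by (simp add: I_def)
qed

text \<open>Without a violation, the answer becomes 1 and the queue is emptied by moving
  \<open>rHead\<close> to \<open>rTail\<close>. With one, the head block is discarded, after its
  children have been appended in case it has more than \<open>k\<close> elements. Its length is
  loaded anew because \<open>push_all\<close> overwrites \<open>rDiff\<close>.\<close>

definition expand :: com where
  "expand = Seq (Const rFound 0) (Seq (search (length c))
    (Seq (IfPos rFound
      (Seq (Load rDiff rHead) (Seq (Sub rDiff rDiff rK) (Seq (IfPos rDiff push_all Skip)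
        (Seq (Load rDiff rHead) (Seq (Add rHead rHead rDiff) (Add rHead rHead rOne))))))
      (Seq (Const rAns 1) (Seq (Sub rDiff rDiff rDiff) (Add rHead rTail rDiff))))
    (Sub rGo rTail rHead)))"

definition expand_time :: "nat \<Rightarrow> nat" where
  "expand_time m = (check_time + 10) * (5 * m + 5) ^ length c + length c * (20 * m + 20) + 20"

definition queue_at :: "nat \<Rightarrow> int list list \<Rightarrow> memory \<Rightarrow> bool" where
  "queue_at k qs R \<longleftrightarrow> R rOne = 1 \<and> R rK = int k \<and> R rHead > 0 \<and> seg R (R rHead) (queue qs) \<and>
     R rTail = R rHead + int (length (queue qs))"

text \<open>The search runs over all tuples with entries in \<open>s\<close>. A failed search
  therefore proves \<open>set s\<close> free, and a successful one leaves the required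
  \<open>y\<close> in the \<open>yreg\<close> registers.\<close>

lemma wp_expand:
  assumes R: "queue_at k (s # qs) R"
  shows "wp expand (\<lambda>t R'. t \<le> expand_time (length s) \<and> R' rGo = R' rTail - R' rHead \<and>
     (L_free c d (set s) \<and> R' rAns = 1 \<and> queue_at k [] R' \<or>
      (\<exists>y. violation y \<and> set y \<subseteq> set s \<and> R' rAns = R rAns \<and>
         queue_at k (qs @ (if k < length s then map (\<lambda>e. removeAll e s) y else [])) R'))) R"
proof -
  let ?R0 = "R(rFound := 0)"
  have S: "wp (search (length c)) (\<lambda>t R'. t \<le> (check_time + 10) * (5 * length s + 5) ^ length c \<and>
     (\<forall>a > rPos. R' a = ?R0 a) \<and>
     (\<forall>j \<ge> length c. R' (xreg j) = ?R0 (xreg j) \<and> R' (preg j) = ?R0 (preg j) \<and> R' (nreg j) = ?R0 (nreg j)) \<and>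
     searched s ({} \<union> tuples s (length c) ?R0) R') ?R0"
    by (rule wp_search[where R = ?R0 and X = "{}"]) (use R in \<open>auto simp: queue_at_def blk_def searched_def\<close>)
  have tuples: "tuples s (length c) ?R0 = {x. length x = length c \<and> set x \<subseteq> set s}"
    by (auto simp: tuples_def subset_code(1) all_set_conv_all_nth)
  show ?thesis
    unfolding expand_def wp_Seq wp_simps
  proof (rule wp_conseq[OF S], elim conjE, goal_cases)
    case (1 t R1)
    from 1 have t: "t \<le> (check_time + 10) * (5 * length s + 5) ^ length c"
      and se: "searched s {x. length x = length c \<and> set x \<subseteq> set s} R1"
      unfolding tuples Un_empty_left by blast+
    from 1 have R1: "R1 a = R a" if "a > rPos" for a using that by simp
    have sg1: "seg R1 (R rHead) (queue (s # qs))"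
      by (subst seg_cong[where R = R]) (use R R1 in \<open>auto simp: queue_at_def\<close>)
    have q: "R rOne = 1" "R rK = int k" "R rHead > 0"
      "R rTail = R rHead + 1 + int (length s) + int (length (queue qs))"
      using R by (auto simp: queue_at_def)
    have hd1: "R1 (R rHead) = int (length s)" using sg1 by (simp add: blk_def)
    show ?case
    proof (cases "R1 rFound > 0")
      case False
      with se have "\<not> violation x" if "set x \<subseteq> set s" for x
        using that by (auto simp: searched_def violation_def is_solution_def)
      then have "L_free c d (set s)" by (auto simp: L_free_def violation_def)
      with False t R1 q show ?thesis by (simp add: expand_time_def queue_at_def)
    next
      case True
      with se have y: "violation (ys_of R1)" "set (ys_of R1) \<subseteq> set s" by (auto simp: searched_def)
      show ?thesis
      proof (cases "k < length s")
        case False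
        have "seg R1 (R rHead + 1 + int (length s)) (queue qs)"
          using sg1 by (simp add: algebra_simps)
        with True False t R1 q hd1 y show ?thesis
          by (simp add: expand_time_def queue_at_def ac_simps) blast
      next
        case k: True
        let ?new = "map (\<lambda>y. removeAll y s) (ys_of R1)"
        let ?R2 = "R1(rDiff := int (length s) - int k)"
        have ys: "ys_of ?R2 = ys_of R1" by (simp add: ys_of_def)
        have P: "wp push_all (\<lambda>t R'. t \<le> 1 + length c * (20 * length s + 20) \<and>
           R' rTail = ?R2 rTail + int (length (queue (map (\<lambda>y. removeAll y s) (ys_of ?R2)))) \<and>
           seg R' (?R2 rTail) (queue (map (\<lambda>y. removeAll y s) (ys_of ?R2))) \<and>
           (\<forall>a < ?R2 rTail. a \<notin> pushRegs \<longrightarrow> R' a = ?R2 a)) ?R2"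
          by (rule wp_push_all[where R = ?R2]) (use R1 q sg1 in auto)
        have R2: "R1(rDiff := R1 (R1 rHead), rDiff := (R1(rDiff := R1 (R1 rHead))) rDiff - (R1(rDiff := R1 (R1 rHead))) rK) = ?R2"
          using R1 q hd1 by simp
        have "wp push_all (\<lambda>t' R'. t' + t + 10 \<le> expand_time (length s) \<and>
           queue_at k (qs @ ?new) (R'(rDiff := R' (R' rHead), rHead := R' rHead + R' (R' rHead) + 1)) \<and>
           R' rOne = 1 \<and> R' rHead > 0 \<and> R' rAns = R rAns) ?R2"
        proof (rule wp_conseq[OF P], elim conjE, goal_cases)
          case (1 u R')
          have R': "R' a = R a" if "a > rPos" "a < R rTail" "a \<noteq> rTail" for a
            using 1 that R1 by simp
          have hd': "R' (R rHead) = int (length s)" using 1 R1 q hd1 by simp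
          have "seg R' (R rHead) (queue (s # qs))"
            by (subst seg_cong[where R = R]) (use R R' in \<open>auto simp: queue_at_def\<close>)
          then have "seg R' (R rHead + 1 + int (length s)) (queue qs)" by (simp add: algebra_simps)
          with 1 t R' hd' q R1 show ?case
            unfolding ys by (simp add: queue_at_def expand_time_def ac_simps)
        qed
        then have "wp push_all (\<lambda>t' R'. t + t' + 10 \<le> expand_time (length s) \<and>
           R' rAns = R rAns \<and> R' rOne = 1 \<and> R' rHead > 0 \<and>
           queue_at k (qs @ ?new) (R'(rDiff := R' (R' rHead), rHead := R' rHead + R' (R' rHead) + 1))) ?R2"
          by (rule wp_conseq) auto
        moreover have "?R2 rDiff > 0" using k by simp
        ultimately show ?thesis
          using True k y
          apply (simp only: wp_IfPos wp_Seq wp_simps R2 if_True simp_thms)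
          apply (erule wp_conseq)
          apply (auto simp: queue_at_def)
          done
      qed
    qed
  qed
qed

section \<open>Combinatorics of branching\<close>

lemma L_free_iff: "L_free c d S \<longleftrightarrow> (\<forall>x. set x \<subseteq> S \<longrightarrow> \<not> violation x)"
  by (auto simp: L_free_def violation_def)

text \<open>Freeness passes to subsets, so any \<open>k\<close> elements of a free set will
  do.\<close>

lemma L_free_subsetI:
  assumes "L_free c d (set s)" "distinct s" "k \<le> length s"
  shows "L_free_subset c d (set s, k)"
proof -
  from assms(2,3) obtain T where "T \<subseteq> set s" "card T = k"
    by (metis distinct_card obtain_subset_with_card_n)
  with assms(1) show ?thesis
    unfolding L_free_subset_def by (auto simp: L_free_iff)
qed

text \<open>At a leaf of the search tree, the only subset of the required size is
  \<open>set s\<close> itself.\<close>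

lemma not_L_free_subset:
  assumes "violation y" "set y \<subseteq> set s" "distinct s" "k = length s"
  shows "\<not> L_free_subset c d (set s, k)"
proof
  assume "L_free_subset c d (set s, k)"
  then obtain T where "T \<subseteq> set s" "card T = k" "L_free c d T"
    by (auto simp: L_free_subset_def)
  moreover from this assms(3,4) have "T = set s" by (simp add: card_subset_eq distinct_card)
  ultimately show False using assms(1,2) by (auto simp: L_free_iff)
qed

text \<open>A free subset cannot contain every value of \<open>y\<close>, so it survives the
  deletion of a missing one. Conversely, deletion creates no new subsets.\<close>

lemma L_free_subset_branch:
  assumes "violation y" "set y \<subseteq> set s"
  shows "L_free_subset c d (set s, k) \<longleftrightarrow> (\<exists>e\<in>set y. L_free_subset c d (set (removeAll e s), k))"
proof
  assume "L_free_subset c d (set s, k)"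
  then obtain T where T: "T \<subseteq> set s" "card T = k" "L_free c d T"
    by (auto simp: L_free_subset_def)
  with assms(1) obtain e where "e \<in> set y" "e \<notin> T" by (auto simp: L_free_iff)
  with T show "\<exists>e\<in>set y. L_free_subset c d (set (removeAll e s), k)"
    by (auto simp: L_free_subset_def intro!: bexI[of _ e] exI[of _ T])
qed (auto simp: L_free_subset_def)

section \<open>Weights bounding the size of the search tree\<close>

definition weight :: "nat \<Rightarrow> int list list \<Rightarrow> nat" where
  "weight k qs = (\<Sum>s\<leftarrow>qs. (length c + 1) ^ (length s - k))"

text \<open>With \<open>l = length c\<close> and \<open>t = length s - k > 0\<close>, the children
  together weigh \<open>l * (l + 1) ^ (t - 1)\<close>, which is less than
  \<open>(l + 1) ^ t\<close>. For \<open>t = 0\<close> there are no children and the set weighs 1.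
  The unit gained pays for processing the set.\<close>

lemma weight_branch:
  assumes "violation y" "set y \<subseteq> set s" "distinct s" "k \<le> length s"
  shows "weight k (if k < length s then map (\<lambda>e. removeAll e s) y else []) + 1
    \<le> (length c + 1) ^ (length s - k)"
proof (cases "k < length s")
  case True
  have "length (removeAll e s) - k = length s - k - 1" if "e \<in> set y" for e
    using that assms(2,3) by (simp add: distinct_remove1_removeAll[symmetric] length_remove1 subset_iff)
  then have "weight k (map (\<lambda>e. removeAll e s) y) = (\<Sum>e\<leftarrow>y. (length c + 1) ^ (length s - k - 1))"
    unfolding weight_def map_map o_def by (intro arg_cong[of _ _ sum_list] map_cong) simp_all
  also have "\<dots> = length c * (length c + 1) ^ (length s - k - 1)"
    using assms(1) by (simp add: sum_list_triv violation_def is_solution_def)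
  finally have "weight k (map (\<lambda>e. removeAll e s) y) + 1 \<le>
      (length c + 1) * (length c + 1) ^ (length s - k - 1)" by simp
  also have "\<dots> = (length c + 1) ^ (length s - k)"
    using True by (simp flip: power_Suc add: Suc_diff_Suc)
  finally show ?thesis using True by simp
qed (use assms in \<open>simp add: weight_def\<close>)

lemma expand_time_mono: "m \<le> n \<Longrightarrow> expand_time m \<le> expand_time n"
  unfolding expand_time_def by (intro add_mono mult_left_mono power_mono) auto

text \<open>Each expansion lowers the total weight by at least 1 and takes at most
  \<open>expand_time (length s)\<close> steps, as no pending set is longer than \<open>s\<close>.
  Weight times this bound, plus 1 for the loop test, is the potential.\<close>

lemma wp_main_loop:
  assumes R: "queue_at k [s] R" "R rGo = R rTail - R rHead" "R rAns = 0"
    and s: "distinct s" "k \<le> length s"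
  shows "wp (WhilePos rGo expand)
    (\<lambda>t R'. t \<le> (length c + 1) ^ (length s - k) * (expand_time (length s) + 1) + 1 \<and>
       R' rAns = of_bool (L_free_subset c d (set s, k))) R"
proof -
  let ?yes = "\<lambda>s. L_free_subset c d (set s, k)"
  let ?B = "expand_time (length s) + 1"
  \<comment> \<open>While \<open>rAns\<close> is 0, the answer for \<open>s\<close> is the
    disjunction of the answers for the pending sets, hence negative once the queue is empty. The
    value 1 occurs only with an empty queue.\<close>
  define I where "I = (\<lambda>qs R'. queue_at k qs R' \<and> R' rGo = R' rTail - R' rHead \<and>
    (\<forall>r\<in>set qs. distinct r \<and> k \<le> length r \<and> length r \<le> length s) \<and>
    (R' rAns = 0 \<and> (?yes s \<longleftrightarrow> (\<exists>r\<in>set qs. ?yes r)) \<or> R' rAns = 1 \<and> ?yes s \<and> qs = []))"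
  have "wp (WhilePos rGo expand) (\<lambda>t R'. t \<le> weight k [s] * ?B + 1 \<and>
    (\<exists>qs. I qs R' \<and> \<not> R' rGo > 0)) R"
  proof (rule wp_WhilePos[where pot = "\<lambda>qs. weight k qs * ?B" and I = I])
    show "I [s] R" using R s by (simp add: I_def)
  next
    fix qs R1 assume I: "I qs R1" and pos: "R1 rGo > 0"
    obtain r qs' where qs: "qs = r # qs'"
      using I pos by (cases qs) (auto simp: I_def queue_at_def)
    have r: "distinct r" "k \<le> length r" "length r \<le> length s" and ans: "R1 rAns = 0"
      and yes: "?yes s \<longleftrightarrow> ?yes r \<or> (\<exists>r\<in>set qs'. ?yes r)"
      and qs': "\<forall>r\<in>set qs'. distinct r \<and> k \<le> length r \<and> length r \<le> length s"
      using I by (auto simp: I_def qs)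
    have w: "weight k qs = (length c + 1) ^ (length r - k) + weight k qs'"
      by (simp add: qs weight_def)
    have "queue_at k (r # qs') R1" using I by (simp add: I_def qs)
    from wp_expand[OF this] show "wp expand (\<lambda>t R'. \<exists>g'. I g' R' \<and> 1 + t + weight k g' * ?B \<le> weight k qs * ?B) R1"
    proof (rule wp_conseq, elim conjE disjE exE)
      fix t R' assume t: "t \<le> expand_time (length r)" and go: "R' rGo = R' rTail - R' rHead"
        and "L_free c d (set r)" "R' rAns = 1" "queue_at k [] R'"
      moreover from this r have "?yes r" by (simp add: L_free_subsetI)
      moreover have "1 + t \<le> 1 * ?B" using t expand_time_mono[OF r(3)] by simp
      \<comment> \<open>The new queue is empty and has potential 0, so the weight of the head, at
        least 1, pays for this last iteration.\<close>
      moreover have "1 * ?B \<le> weight k qs * ?B"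
      proof (rule mult_right_mono)
        have "1 \<le> (length c + 1) ^ (length r - k)" by (rule one_le_power) simp
        then show "1 \<le> weight k qs" unfolding w by (rule trans_le_add1)
      qed simp
      ultimately show "\<exists>g'. I g' R' \<and> 1 + t + weight k g' * ?B \<le> weight k qs * ?B"
        by (intro exI[of _ "[]"]) (simp add: I_def yes weight_def)
    next
      fix t R' y
      define new where "new = (if k < length r then map (\<lambda>e. removeAll e r) y else [])"
      assume t: "t \<le> expand_time (length r)" and go: "R' rGo = R' rTail - R' rHead"
        and y: "violation y" "set y \<subseteq> set r" and "R' rAns = R1 rAns" 
        and "queue_at k (qs' @ (if k < length r then map (\<lambda>e. removeAll e r) y else [])) R'"
      then have q: "queue_at k (qs' @ new) R'" and ans': "R' rAns = 0" by (simp_all add: new_def ans)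
      have "?yes r \<longleftrightarrow> (\<exists>r\<in>set new. ?yes r)"
        using L_free_subset_branch[OF y, of k] not_L_free_subset[OF y r(1), of k] r(2)
        by (cases "k < length r") (simp_all add: new_def)
      moreover have "\<forall>r\<in>set new. distinct r \<and> k \<le> length r \<and> length r \<le> length s"
      proof -
        have "length r \<le> Suc (length (removeAll e r))" for e
          using r(1) by (auto simp: distinct_remove1_removeAll[symmetric] length_remove1)
        then have "k < length r \<Longrightarrow> k \<le> length (removeAll e r)" for e
          by (metis less_Suc_eq_le order_less_le_trans)
        moreover have "length (removeAll e r) \<le> length s" for e
          using r(3) by (simp add: removeAll_filter_not_eq le_trans[OF length_filter_le])
        ultimately show ?thesis using r(1) by (auto simp: new_def distinct_removeAll)
      qed
      ultimately have "I (qs' @ new) R'"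
        unfolding I_def using q go yes qs' ans' by auto
      moreover have "1 + t + weight k (qs' @ new) * ?B \<le> weight k qs * ?B"
      proof -
        have "weight k (qs' @ new) + 1 \<le> weight k qs"
          using weight_branch[OF y r(1,2)] unfolding w new_def by (simp add: weight_def)
        moreover have "1 + t \<le> ?B" using t expand_time_mono[OF r(3)] by simp
        moreover have "1 + t + V * B \<le> W * B" if "V + 1 \<le> W" "1 + t \<le> B" for V W B :: nat
          using mult_right_mono[OF that(1), of B] that(2) by simp
        ultimately show ?thesis by blast
      qed
      ultimately show "\<exists>g'. I g' R' \<and> 1 + t + weight k g' * ?B \<le> weight k qs * ?B" by blast
    qed
  qed
  then show ?thesis
  proof (rule wp_conseq, elim conjE exE)
    fix t R' qs assume t: "t \<le> weight k [s] * ?B + 1" and I: "I qs R'" and "\<not> R' rGo > 0"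
    then have "qs = []" by (cases qs) (auto simp: I_def queue_at_def)
    with I t show "t \<le> (length c + 1) ^ (length s - k) * ?B + 1 \<and> R' rAns = of_bool (?yes s)"
      by (auto simp: I_def weight_def)
  qed
qed

end

section \<open>Reading the instance\<close>

definition read_int :: com where
  "read_int = Seq (Load rSign rPos) (Seq (Add rPos rPos rOne) (Seq decode
     (IfPos rSign (Seq (Sub rTmp rVal rVal) (Sub rVal rTmp rVal)) Skip)))"

lemma wp_read_int:
  assumes R: "R rOne = 1" "R rPos > 0" "seg R (R rPos) (map of_bool (encode_int z))"
  shows "wp read_int (\<lambda>t R'. t \<le> 10 * length (encode_int z) \<and> R' rVal = z \<and>
     R' rPos = R rPos + int (length (encode_int z)) \<and>
     (\<forall>a. a \<notin> {rPos, rVal, rPow, rTmp, rSign} \<longrightarrow> R' a = R a)) R"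
  unfolding read_int_def wp_Seq wp_simps
proof (rule wp_decode[where v = "nat \<bar>z\<bar>"], goal_cases)
  case 3
  show ?case using R by (auto simp: encode_int_def)
next
  case (4 t R')
  have "R (R rPos) = of_bool (z < 0)" using R(3) by (simp add: encode_int_def)
  with 4 R(1,2) show ?case by (auto simp: encode_int_def)
qed (use R in auto)

text \<open>The list of elements has no end marker. Register 0 still holds the input length
  \<open>n\<close>, and the loop is driven by the number \<open>n + 1 - rPos\<close> of unread
  bits.\<close>

definition read_all :: com where
  "read_all = WhilePos rGo (Seq read_int (Seq (Store rTail rVal) (Seq (Add rTail rTail rOne)
     (Seq (Add rCnt rCnt rOne) (Seq (Sub rGo 0 rPos) (Add rGo rGo rOne))))))"

lemma wp_read_all:
  fixes n :: int
  defines "enc \<equiv> \<lambda>zs. concat (map encode_int zs)"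
  assumes R: "R rOne = 1" "R 0 = n" "R rPos > 0" "R rPos + int (length (enc zs)) = n + 1"
    "seg R (R rPos) (map of_bool (enc zs))" "R rGo = n + 1 - R rPos" "R rTail = n + 2" "R rCnt = 0"
  shows "wp read_all (\<lambda>t R'. t \<le> 20 * length (enc zs) + 1 \<and> seg R' (n + 2) zs \<and>
     R' rTail = n + 2 + int (length zs) \<and> R' rCnt = int (length zs) \<and>
     R' rOne = 1 \<and> R' rK = R rK \<and> R' rHead = R rHead) R"
proof -
  define I where "I = (\<lambda>(us, vs) R'. zs = us @ vs \<and> R' rOne = 1 \<and> R' rK = R rK \<and> R' rHead = R rHead \<and>
    R' 0 = n \<and> R' rPos > 0 \<and> R' rPos + int (length (enc vs)) = n + 1 \<and>
    seg R' (R' rPos) (map of_bool (enc vs)) \<and> R' rGo = n + 1 - R' rPos \<and>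
    R' rTail = n + 2 + int (length us) \<and> R' rCnt = int (length us) \<and> seg R' (n + 2) us)"
  have "wp read_all (\<lambda>t R'. t \<le> 20 * length (enc (snd ([] :: int list, zs))) + 1 \<and>
    (\<exists>g. I g R' \<and> \<not> R' rGo > 0)) R"
    unfolding read_all_def
  proof (rule wp_WhilePos[where pot = "\<lambda>g. 20 * length (enc (snd g))" and I = I and g = "([], zs)"])
    show "I ([], zs) R" using R by (simp add: I_def)
  next
    fix g R1 assume I: "I g R1" and pos: "R1 rGo > 0"
    obtain us z vs where g: "g = (us, z # vs)" using I pos
      by (cases g; cases "snd g") (auto simp: I_def enc_def)
    have zs: "zs = us @ z # vs"
      and R1: "R1 rOne = 1" "R1 rK = R rK" "R1 rHead = R rHead" "R1 0 = n" "R1 rPos > 0"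
        "R1 rPos + int (length (enc (z # vs))) = n + 1"
        "R1 rTail = n + 2 + int (length us)" "R1 rCnt = int (length us)"
      and sg: "seg R1 (R1 rPos) (map of_bool (enc (z # vs)))" "seg R1 (n + 2) us"
      using I unfolding I_def g prod.case by blast+
    have enc: "enc (z # vs) = encode_int z @ enc vs" by (simp add: enc_def)
    \<comment> \<open>A sign bit and a terminator are always present, so the gap between 10 and 20
      steps per bit pays for the other instructions of the iteration.\<close>
    have len: "length (encode_int z) \<ge> 2" by (simp add: encode_int_def encode_nat_def)
    have "wp read_int (\<lambda>t R'. t \<le> 10 * length (encode_int z) \<and> R' rVal = z \<and>
       R' rPos = R1 rPos + int (length (encode_int z)) \<and>
       (\<forall>a. a \<notin> {rPos, rVal, rPow, rTmp, rSign} \<longrightarrow> R' a = R1 a)) R1"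
      by (rule wp_read_int) (use R1 sg in \<open>simp_all add: enc\<close>)
    then show "wp (Seq read_int (Seq (Store rTail rVal) (Seq (Add rTail rTail rOne)
        (Seq (Add rCnt rCnt rOne) (Seq (Sub rGo 0 rPos) (Add rGo rGo rOne))))))
      (\<lambda>t R'. \<exists>g'. I g' R' \<and> 1 + t + 20 * length (enc (snd g')) \<le> 20 * length (enc (snd g))) R1"
      unfolding wp_Seq wp_simps
    proof (rule wp_conseq, elim conjE, intro exI[of _ "(us @ [z], vs)"], goal_cases)
      case (1 t R2)
      have R2: "R2 a = R1 a" if "a > rPos" for a using 1 that by simp
      have "seg R2 (n + 2) us" using sg(2) R1(4-6)
        by (subst seg_cong[where R = R1]) (auto simp: R2)
      moreover have "seg R2 (R2 rPos) (map of_bool (enc vs))"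
      proof (subst seg_cong[where R = R1])
        show "seg R1 (R2 rPos) (map of_bool (enc vs))" using sg(1) 1 by (simp add: enc)
        show "R2 b = R1 b" if "R2 rPos \<le> b" for b using that 1 R1(5) by (intro R2) simp
      qed
      ultimately show ?case
        using 1 R1 R2 len by (simp add: I_def g zs enc)
    qed
  qed
  then show ?thesis
  proof (rule wp_conseq, elim conjE exE)
    fix t R' g assume t: "t \<le> 20 * length (enc (snd ([] :: int list, zs))) + 1" and I: "I g R'" and "\<not> R' rGo > 0"
    then obtain us where "g = (us, [])"
      by (cases g; cases "snd g") (auto simp: I_def enc_def encode_int_def)
    with I t show "t \<le> 20 * length (enc zs) + 1 \<and> seg R' (n + 2) zs \<and>
     R' rTail = n + 2 + int (length zs) \<and> R' rCnt = int (length zs) \<and>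
     R' rOne = 1 \<and> R' rK = R rK \<and> R' rHead = R rHead"
      by (simp add: I_def)
  qed
qed

text \<open>If \<open>k > |A|\<close>, register \<open>rGo\<close> ends up nonpositive, so that the main loop is skipped and the answer
  remains 0.\<close>

definition enqueue :: com where
  "enqueue = Seq (Store rHead rCnt) (Seq (Const rAns 0) (Seq (Sub rGo rCnt rK)
     (Seq (Add rGo rGo rOne) (IfPos rGo (Sub rGo rTail rHead) Skip))))"

text \<open>\<open>rHead\<close> becomes the first register beyond the input and
  \<open>rTail\<close> the one after it; the gap is for the length of the block, which
  \<open>enqueue\<close> fills in once the elements are counted.\<close>

definition init :: com where
  "init = Seq (Const rOne 1) (Seq (Const rPos 1) (Seq decode (Seq (Const rTmp 0) (Seq (Add rK rVal rTmp)
     (Seq (Add rHead 0 rOne) (Seq (Add rTail rHead rOne) (Seq (Const rCnt 0)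
     (Seq (Sub rGo 0 rPos) (Seq (Add rGo rGo rOne) (Seq read_all enqueue))))))))))"

lemma seg_input: "seg (input_memory w) 1 (map of_bool w)"
  by (rule seg_nth) (simp add: input_memory_def)

text \<open>The test value \<open>length s - k + 1\<close>, taken over the integers, is positive
  exactly if \<open>k \<le> length s\<close>. The summand 1 admits equality, where the whole set
  still has to be examined.\<close>

lemma wp_init:
  assumes w: "w = encode_nat k @ concat (map encode_int s)"
  shows "wp init (\<lambda>t R'. t \<le> 30 * length w + 20 \<and> queue_at k [s] R' \<and> R' rAns = 0 \<and>
     R' rGo = (if k \<le> length s then R' rTail - R' rHead else int (length s) - int k + 1)) (input_memory w)"
proof -
  let ?n = "int (length w)"
  let ?M = "(input_memory w)(rOne := 1, rPos := 1)"
  have M: "seg ?M 1 (map of_bool w)" using seg_input[of w] by simp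
  show ?thesis
    unfolding init_def wp_Seq wp_simps
  proof (rule wp_decode[where v = k], goal_cases)
    case 3
    show ?case using M by (simp add: w)
  next
    case (4 t R)
    let ?p = "1 + int (length (encode_nat k))"
    let ?R = "R(rTmp := 0, rK := int k, rHead := ?n + 1, rTail := ?n + 1 + 1, rCnt := 0, rGo := ?n + 1 - ?p)"
    have R: "R a = ?M a" if "a \<ge> 0" for a using 4 that by simp
    have R0: "R 0 = ?n" "R rOne = 1" "R rVal = int k" "R rPos = ?p"
      using 4 by (auto simp: input_memory_def)
    have W: "wp read_all (\<lambda>t R'. t \<le> 20 * length (concat (map encode_int s)) + 1 \<and> seg R' (?n + 2) s \<and>
       R' rTail = ?n + 2 + int (length s) \<and> R' rCnt = int (length s) \<and>
       R' rOne = 1 \<and> R' rK = ?R rK \<and> R' rHead = ?R rHead) ?R"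
    proof (rule wp_read_all)
      have "seg R ?p (map of_bool (concat (map encode_int s)))"
      proof (subst seg_cong[where R = ?M])
        show "seg ?M ?p (map of_bool (concat (map encode_int s)))"
          using M unfolding w by simp
      qed (use R in auto)
      then show "seg ?R (?R rPos) (map of_bool (concat (map encode_int s)))" using R0 by simp
    qed (use R0 w in auto)
    have fin: "wp enqueue (\<lambda>t R'. t \<le> 6 \<and> queue_at k [s] R' \<and> R' rAns = 0 \<and>
        R' rGo = (if k \<le> length s then R' rTail - R' rHead else int (length s) - int k + 1)) R'"
      if "seg R' (?n + 2) s" "R' rTail = ?n + 2 + int (length s)" "R' rCnt = int (length s)"
        "R' rOne = 1" "R' rK = int k" "R' rHead = ?n + 1" for R'
      using that by (simp add: enqueue_def queue_at_def blk_def ac_simps)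
    have len: "length w = length (encode_nat k) + length (concat (map encode_int s))" by (simp add: w)
    show ?case
    proof (rule wp_conseq, rule back_subst[where P = "wp read_all _", OF W], goal_cases)
      case 1
      show ?case using R0 by (simp add: fun_eq_iff)
    next
      case (2 t' R')
      then have "wp enqueue (\<lambda>t R'. t \<le> 6 \<and> queue_at k [s] R' \<and> R' rAns = 0 \<and>
        R' rGo = (if k \<le> length s then R' rTail - R' rHead else int (length s) - int k + 1)) R'"
        by (intro fin) auto
      then show ?case by (rule wp_conseq) (use 2 4(1) len in auto)
    qed
  qed (simp_all)
qed

section \<open>The decision procedure\<close>

definition program :: "int list \<Rightarrow> int \<Rightarrow> com" where
  "program c d = Seq init (Seq (WhilePos rGo (expand c d)) (Seq (Const rTmp 0) (Add 0 rAns rTmp)))"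

lemma wp_program:
  fixes A :: "int set" and k :: nat
  assumes "finite A"
  defines "w \<equiv> encode_instance (A, k)"
  shows "wp (program c d) (\<lambda>t R. t \<le> 30 * length w + 30 +
      (length c + 1) ^ (card A - k) * (expand_time c (card A) + 1) \<and>
      R 0 = of_bool (L_free_subset c d (A, k))) (input_memory w)"
proof -
  let ?s = "sorted_list_of_set A"
  have s: "distinct ?s" "set ?s = A" "length ?s = card A" using assms by simp_all
  have w: "w = encode_nat k @ concat (map encode_int ?s)" by (simp add: w_def encode_instance_def)
  show ?thesis
    unfolding program_def wp_Seq
  proof (rule wp_conseq[OF wp_init[OF w]], elim conjE, goal_cases)
    case (1 t R)
    from 1 have t: "t \<le> 30 * length w + 20" and R: "queue_at k [?s] R" "R rAns = 0"
      and go: "R rGo = (if k \<le> length ?s then R rTail - R rHead else int (length ?s) - int k + 1)"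
      by blast+
    have "wp (WhilePos rGo (expand c d)) (\<lambda>t R'.
        t \<le> (length c + 1) ^ (card A - k) * (expand_time c (card A) + 1) + 1 \<and>
        R' rAns = of_bool (L_free_subset c d (A, k))) R"
    proof (cases "k \<le> card A")
      case True
      with wp_main_loop[OF R(1) _ R(2) s(1), of c d] go s show ?thesis by simp
    next
      case False
      \<comment> \<open>No subset of \<open>A\<close> has more than \<open>card A\<close> elements,
        and the skipped loop leaves the answer 0.\<close>
      then have "\<not> L_free_subset c d (A, k)"
        using card_mono[OF \<open>finite A\<close>] by (auto simp: L_free_subset_def)
      moreover have "\<not> R rGo > 0" using False go s by simp
      ultimately show ?thesis
        using R(2) exec.WhileFalse[of R rGo "expand c d"] unfolding wp_def by fastforce
    qed
    then show ?case by (rule wp_conseq) (use t in auto)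
  qed
qed

section \<open>Parameter function and time bound\<close>

lemma computable_exponential: "computable (\<lambda>m. a * b ^ m)"
proof -
  define body where "body = Seq (Const rTmp 0) (Seq (add_multiple (int b) rVal rTmp)
    (Seq (Const rNeg 0) (Seq (Add rVal rTmp rNeg) (Sub 0 0 rOne))))"
  define p where "p = Seq (Const rOne 1) (Seq (Const rVal (int a)) (Seq (WhilePos 0 body)
    (Seq (Const rNeg 0) (Add 0 rVal rNeg))))"
  have "wp p (\<lambda>t R. R 0 = int (a * b ^ m)) ((\<lambda>_. 0)(0 := int m))" for m
  proof -
    \<comment> \<open>\<open>j\<close> counts the multiplications left; each moves one factor
      \<open>b\<close> from the power into the accumulator \<open>rVal\<close>.\<close>
    define I where "I = (\<lambda>j R. R 0 = int j \<and> R rOne = 1 \<and> R rVal * int b ^ j = int (a * b ^ m))"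
    let ?R = "(\<lambda>_. 0)(0 := int m, rOne := 1, rVal := int a)"
    have "wp (WhilePos 0 body) (\<lambda>t R'. t \<le> m * (b + 10) + 1 \<and> (\<exists>j. I j R' \<and> \<not> R' 0 > 0)) ?R"
    proof (rule wp_WhilePos[where pot = "\<lambda>j. j * (b + 10)" and I = I])
      show "I m ?R" by (simp add: I_def)
    next
      fix j R assume "I j R" "R 0 > 0"
      then obtain i where "j = Suc i" "I (Suc i) R" by (cases j) (auto simp: I_def)
      then show "wp body (\<lambda>t R'. \<exists>i. I i R' \<and> 1 + t + i * (b + 10) \<le> j * (b + 10)) R"
        unfolding body_def by (auto simp: I_def mult_ac intro!: exI[of _ i])
    qed
    then show ?thesis
      unfolding p_def wp_Seq wp_simps by (rule wp_conseq) (auto simp: I_def)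
  qed
  then show ?thesis unfolding computable_def wp_def by blast
qed

text \<open>Each element contributes at least its sign bit; strictness comes from the terminator of
  the code of \<open>k\<close>.\<close>

lemma card_less_length_encode:
  assumes "finite A"
  shows "card A < length (encode_instance (A, k))"
proof -
  have "length zs \<le> length (concat (map encode_int zs))" for zs
    by (induction zs) (auto simp: encode_int_def)
  from this[of "sorted_list_of_set A"] show ?thesis
    by (simp add: encode_instance_def encode_nat_def)
qed

text \<open>Each summand is compared with the power separately, using \<open>m + 1 \<le> n\<close>.
  The exponent is at least 1, so \<open>n\<close> itself lies below the power, which covers the
  linear term.\<close>

lemma expand_time_bound:
  assumes "m < n"
  shows "expand_time c m + 1 \<le>
    ((check_time c + 10) * 5 ^ length c + 20 * length c + 21) * n ^ (length c + 1)"
proof -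
  let ?l = "length c"
  have n: "n > 0" using assms by simp
  have "(5 * m + 5) ^ ?l = 5 ^ ?l * (m + 1) ^ ?l"
    unfolding power_mult_distrib[symmetric] by (simp add: algebra_simps)
  also have "\<dots> \<le> 5 ^ ?l * n ^ ?l" using assms by (intro mult_left_mono power_mono) auto
  also have "\<dots> \<le> 5 ^ ?l * n ^ (?l + 1)" using n by (intro mult_left_mono power_increasing) auto
  finally have 1: "(check_time c + 10) * (5 * m + 5) ^ ?l \<le> (check_time c + 10) * 5 ^ ?l * n ^ (?l + 1)"
    unfolding mult.assoc by (rule mult_left_mono) simp
  have n': "n \<le> n ^ (?l + 1)" using n by simp
  have "?l * (20 * m + 20) = 20 * ?l * (m + 1)" by (simp add: algebra_simps)
  also have "\<dots> \<le> 20 * ?l * n ^ (?l + 1)"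
  proof (rule mult_left_mono)
    show "m + 1 \<le> n ^ (?l + 1)" using assms n' by linarith
  qed simp
  finally have 2: "?l * (20 * m + 20) \<le> 20 * ?l * n ^ (?l + 1)" .
  have 3: "21 \<le> 21 * n ^ (?l + 1)" using n by simp
  from 1 2 3 show ?thesis unfolding expand_time_def distrib_right by linarith
qed

theorem theorem5p3:
  fixes c :: "int list" and d :: int
  shows "FPT instances encode_instance (L_free_subset c d) deletion_parameter"
proof -
  let ?l = "length c"
  \<comment> \<open>\<open>C * n ^ (?l + 1)\<close> bounds the cost of one expansion with its loop
    test. The witnesses for \<open>FPT\<close> are \<open>f p = (C + 60) * (?l + 1) ^ p\<close> and
    \<open>e = ?l + 1\<close>, where 60 covers the initial reading, as
    \<open>30 * n + 30 \<le> 60 * n\<close>.\<close>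
  define C where "C = (check_time c + 10) * 5 ^ ?l + 20 * ?l + 21"
  have "decides_within (program c d) (encode_instance x) (L_free_subset c d x)
      ((C + 60) * (?l + 1) ^ deletion_parameter x * length (encode_instance x) ^ (?l + 1))"
    if "x \<in> instances" for x
  proof -
    obtain A k where x: "x = (A, k)" by (cases x)
    with that have A: "finite A" by (simp add: instances_def)
    let ?n = "length (encode_instance x)" and ?P = "(?l + 1) ^ (card A - k)"
    have n: "card A < ?n" using card_less_length_encode[OF A] by (simp add: x)
    then have "30 * ?n + 30 \<le> 60 * ?n" by simp
    also have "\<dots> \<le> 60 * ?n ^ (?l + 1)" using n by simp
    also have "\<dots> \<le> 60 * ?n ^ (?l + 1) * ?P" by simp
    finally have "30 * ?n + 30 + ?P * (expand_time c (card A) + 1)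
        \<le> 60 * ?n ^ (?l + 1) * ?P + ?P * (C * ?n ^ (?l + 1))"
      using expand_time_bound[OF n, of c] unfolding C_def by (intro add_mono mult_left_mono) auto
    also have "\<dots> = (C + 60) * ?P * ?n ^ (?l + 1)" by (simp add: algebra_simps)
    finally have "wp (program c d) (\<lambda>t R. t \<le> (C + 60) * ?P * ?n ^ (?l + 1) \<and>
        R 0 = of_bool (L_free_subset c d x)) (input_memory (encode_instance x))"
      unfolding x by (intro wp_conseq[OF wp_program[OF A]]) (blast intro: order_trans)
    then show ?thesis
      unfolding wp_def decides_within_def by (simp only: x deletion_parameter_def prod.case)
  qed
  with computable_exponential[of "C + 60" "?l + 1"] show ?thesis
    unfolding FPT_def by blast
qed

end
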